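(* Let $d\in\mathbb{N}$, let $W\subset\mathbb{R}^d$ be a non-empty bounded open set and let $\Phi_1,\Phi_2,\ldots$ be independent and identically distributed point processes on $\mathbb{R}^d$ observed in $W$, with well-defined intensity function $\lambda$ and pair correlation function $g$. Suppose that $g:W\times W\to\mathbb{R}$ is bounded and that $\lambda:W\to(0,\infty)$ is twice continuously differentiable with second order partial derivatives $\lambda_{ij}=D_{ij}\lambda$, $i,j=1,\dots,d$, that are Hölder continuous with index $\alpha>0$ on $W$, that is, there exists $C>0$ such that $|\lambda_{ij}(x)-\lambda_{ij}(y)|\le C\|x-y\|^\alpha$ for all $x,y\in W$ and all $i,j$. Let $\gamma\ge 0$ and let $(h_n)_{n\in\mathbb{N}}$ be a sequence of positive bandwidths with $h_n\to0$ and $nh_n^d\to\infty$ as $n\to\infty$. For $x_0\in W$ consider the estimator \[ \widehat{\lambda(x_0)}=\frac{1}{n h_n^d}\sum_{i=1}^n\sum_{y\in\Phi_i\cap W}\kappa^\gamma\Big(\frac{x_0-y}{h_n}\Big), \] where $\kappa^\gamma$ is the Beta kernel. Then, as $n\to\infty$, \[ \mathrm{mse}\,\widehat{\lambda(x_0)}=h_n^4\,\frac{V(d,\gamma)^2}{4}\Big(\sum_{i=1}^d\lambda_{ii}(x_0)\Big)^2+\frac{\lambda(x_0)Q(d,\gamma)}{nh_n^d}+O(h_n^{4+\alpha})+O\Big(\frac{1}{nh_n^{d-1}}\Big). \] The asymptotic mean squared error is optimised at \[ h_n^*(x_0)=\frac{1}{n^{1/(d+4)}}\left(\frac{d\,\lambda(x_0)\,Q(d,\gamma)}{V(d,\gamma)^2\big(\sum_{i=1}^d\lambda_{ii}(x_0)\big)^2}\right)^{1/(d+4)}.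 \]
   Context: Point processes: the factorial moment measures of $\Phi_1$ of first and second order exist (as locally finite measures) and, on $W$ and $W\times W$ respectively, are absolutely continuous with respect to Lebesgue measure with densities $\lambda$ (the intensity function) and $\rho^{(2)}$ (the second order product density). That is, $\mathbb{E}\sum_{y\in\Phi_1\cap W}f(y)=\int_W f\lambda\,du$ and $\mathbb{E}\sum_{y\ne z\in\Phi_1\cap W}f(y,z)=\int_{W^2}f\rho^{(2)}\,du\,dv$ for non-negative measurable $f$. The pair correlation function is $g(u,v)=\rho^{(2)}(u,v)/(\lambda(u)\lambda(v))$ for $u,v\in W$. Beta kernel: for $\gamma\ge0$, $\kappa^\gamma(x)=c(d,\gamma)^{-1}(1-x^Tx)^\gamma\,1\{x\in b(0,1)\}$, $x\in\mathbb{R}^d$, where $b(0,1)$ is the closed unit ball of $\mathbb{R}^d$ centred at the origin and $c(d,\gamma)=\int_{b(0,1)}(1-x^Tx)^\gamma dx=\pi^{d/2}\Gamma(\gamma+1)/\Gamma(d/2+\gamma+1)$. Constants: $Q(d,\gamma)=\int_{\mathbb{R}^d}\kappa^\gamma(x)^2dx=c(d,2\gamma)/c(d,\gamma)^2$ and $V(d,\gamma)=\int_{\mathbb{R}^d}x_1^2\kappa^\gamma(x)dx=1/(d+2\gamma+2)$. The mean squared error is $\mathrm{mse}\,\widehat{\lambda(x_0)}=\mathbb{E}\big[(\widehat{\lambda(x_0)}-\lambda(x_0))^2\big]$. The asymptotic mean squared error, as a function of the bandwidth $h>0$ for fixed $n$, is the sum of the leading terms $h^4\frac{V(d,\gamma)^2}{4}\big(\sum_{i}\lambda_{ii}(x_0)\big)^2+\frac{\lambda(x_0)Q(d,\gamma)}{nh^d}$;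 optimised means minimised over $h>0$. $D_{ij}$ denotes second order partial derivatives. *)

theory Defs
  imports "HOL-Probability.Probability" "HOL-Library.Landau_Symbols"
begin

(* Throughout, R^d is real ^ 'n with d = CARD('n). *)

section \<open>Point processes\<close>

(* Locally finite subsets of the ambient space, with the smallest sigma-algebra that makes the
   counts of points in bounded Borel sets measurable. *)
definition configurations :: "'a::metric_space set set" where
  "configurations = {S. \<forall>B. bounded B \<longrightarrow> finite (S \<inter> B)}"

definition config_space :: "'a::metric_space set measure" where
  "config_space = sigma configurations
     {{S \<in> configurations. card (S \<inter> B) = k} | B k. B \<in> sets borel \<and> bounded B}"

definition point_process :: "'m measure \<Rightarrow> ('m \<Rightarrow> 'a::metric_space set) \<Rightarrow> bool" where
  "point_process M X \<longleftrightarrow> X \<in> measurable M config_space"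

definition iid_point_processes ::
    "'m measure \<Rightarrow> (nat \<Rightarrow> 'm \<Rightarrow> 'a::metric_space set) \<Rightarrow> bool" where
  "iid_point_processes M \<Phi> \<longleftrightarrow>
     (\<forall>i\<ge>1. point_process M (\<Phi> i)) \<and>
     prob_space.indep_vars M (\<lambda>_. config_space) \<Phi> {1..} \<and>
     (\<forall>i\<ge>1. distr M config_space (\<Phi> i) = distr M config_space (\<Phi> 1))"

definition distinct_pairs :: "'a set \<Rightarrow> ('a \<times> 'a) set" where
  "distinct_pairs S = {(y, z). y \<in> S \<and> z \<in> S \<and> y \<noteq> z}"

(* Factorial moment measures of order one and two, as set functions; sums of [0,\<infinity>]-valued functions
   over the points of a configuration are integrals over the counting measure, so that the number
   of points is allowed to be infinite. *)
definition moment_measure :: "'m measure \<Rightarrow> ('m \<Rightarrow> 'a set) \<Rightarrow> 'a set \<Rightarrow> ennreal" where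
  "moment_measure M X B = (\<integral>\<^sup>+\<omega>. emeasure (count_space UNIV) (X \<omega> \<inter> B) \<partial>M)"

definition factorial_moment2 ::
    "'m measure \<Rightarrow> ('m \<Rightarrow> 'a set) \<Rightarrow> ('a \<times> 'a) set \<Rightarrow> ennreal" where
  "factorial_moment2 M X B =
     (\<integral>\<^sup>+\<omega>. emeasure (count_space UNIV) (distinct_pairs (X \<omega>) \<inter> B) \<partial>M)"

definition has_intensity_function ::
    "'m measure \<Rightarrow> ('m \<Rightarrow> 'a::euclidean_space set) \<Rightarrow> 'a set \<Rightarrow> ('a \<Rightarrow> real) \<Rightarrow> bool" where
  "has_intensity_function M X W l \<longleftrightarrow>
     (\<forall>B\<in>sets borel. bounded B \<longrightarrow> moment_measure M X B < \<infinity>) \<and>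
     l \<in> borel_measurable (restrict_space borel W) \<and>
     (\<forall>u\<in>W. 0 \<le> l u) \<and>
     (\<forall>f :: 'a \<Rightarrow> ennreal. f \<in> borel_measurable borel \<longrightarrow>
        (\<integral>\<^sup>+\<omega>. (\<integral>\<^sup>+y. f y \<partial>count_space (X \<omega> \<inter> W)) \<partial>M) =
        (\<integral>\<^sup>+u\<in>W. (f u * ennreal (l u)) \<partial>lborel))"

definition has_product_density2 ::
    "'m measure \<Rightarrow> ('m \<Rightarrow> 'a::euclidean_space set) \<Rightarrow> 'a set \<Rightarrow> ('a \<times> 'a \<Rightarrow> real) \<Rightarrow> bool" where
  "has_product_density2 M X W r \<longleftrightarrow>
     (\<forall>B\<in>sets borel. bounded B \<longrightarrow> factorial_moment2 M X B < \<infinity>) \<and>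
     r \<in> borel_measurable (restrict_space borel (W \<times> W)) \<and>
     (\<forall>p\<in>W \<times> W. 0 \<le> r p) \<and>
     (\<forall>f :: 'a \<times> 'a \<Rightarrow> ennreal. f \<in> borel_measurable borel \<longrightarrow>
        (\<integral>\<^sup>+\<omega>. (\<integral>\<^sup>+p. f p \<partial>count_space (distinct_pairs (X \<omega> \<inter> W))) \<partial>M) =
        (\<integral>\<^sup>+p\<in>W \<times> W. (f p * ennreal (r p)) \<partial>lborel))"

definition pair_correlation :: "('a \<Rightarrow> real) \<Rightarrow> ('a \<times> 'a \<Rightarrow> real) \<Rightarrow> 'a \<times> 'a \<Rightarrow> real" where
  "pair_correlation l r = (\<lambda>(u, v). r (u, v) / (l u * l v))"

section \<open>Partial derivatives\<close>

(* Total functions stand for functions on an open set W: only the values on W matter. *)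
definition partial :: "'n::finite \<Rightarrow> (real ^ 'n \<Rightarrow> real) \<Rightarrow> real ^ 'n \<Rightarrow> real" where
  "partial i f x = frechet_derivative f (at x) (axis i 1)"

definition C1_on :: "(real ^ 'n::finite) set \<Rightarrow> (real ^ 'n \<Rightarrow> real) \<Rightarrow> bool" where
  "C1_on W f \<longleftrightarrow> f differentiable_on W \<and> (\<forall>i. continuous_on W (partial i f))"

definition C2_on :: "(real ^ 'n::finite) set \<Rightarrow> (real ^ 'n \<Rightarrow> real) \<Rightarrow> bool" where
  "C2_on W f \<longleftrightarrow> C1_on W f \<and> (\<forall>i. C1_on W (partial i f))"

abbreviation partial2 :: "'n::finite \<Rightarrow> 'n \<Rightarrow> (real ^ 'n \<Rightarrow> real) \<Rightarrow> real ^ 'n \<Rightarrow> real" where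
  "partial2 i j f \<equiv> partial i (partial j f)"

section \<open>Beta kernels\<close>

(* t^\<gamma> for t \<ge> 0 and \<gamma> \<ge> 0 with 0^0 = 1, whereas 0 powr 0 = 0: for \<gamma> = 0 the kernel is
   the uniform density on the closed ball, boundary included. *)
definition rpow :: "real \<Rightarrow> real \<Rightarrow> real" where
  "rpow t \<gamma> = (if \<gamma> = 0 then 1 else t powr \<gamma>)"

definition beta_c :: "'n::finite itself \<Rightarrow> real \<Rightarrow> real" where
  "beta_c _ \<gamma> = (LINT x:cball (0 :: real ^ 'n) 1|lborel. rpow (1 - x \<bullet> x) \<gamma>)"

definition beta_kernel :: "real \<Rightarrow> real ^ 'n::finite \<Rightarrow> real" where
  "beta_kernel \<gamma> x =
     inverse (beta_c TYPE('n) \<gamma>) * rpow (1 - x \<bullet> x) \<gamma> * indicator (cball 0 1) x"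

definition beta_Q :: "'n::finite itself \<Rightarrow> real \<Rightarrow> real" where
  "beta_Q _ \<gamma> = (LINT x|lborel. (beta_kernel \<gamma> (x :: real ^ 'n))\<^sup>2)"

(* The coordinates of real ^ 'n are not ordered, so the coordinate k playing the role of the
   first one is a parameter. *)
definition beta_V :: "'n::finite \<Rightarrow> real \<Rightarrow> real" where
  "beta_V k \<gamma> = (LINT x|lborel. (x $ k)\<^sup>2 * beta_kernel \<gamma> (x :: real ^ 'n))"

section \<open>The kernel estimator and its mean squared error\<close>

definition kernel_estimator ::
    "real \<Rightarrow> (real ^ 'n::finite) set \<Rightarrow> (nat \<Rightarrow> 'm \<Rightarrow> (real ^ 'n) set) \<Rightarrow>
     nat \<Rightarrow> real \<Rightarrow> real ^ 'n \<Rightarrow> 'm \<Rightarrow> real" where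
  "kernel_estimator \<gamma> W \<Phi> n h x\<^sub>0 \<omega> =
     1 / (real n * h ^ CARD('n)) *
     (\<Sum>i=1..n. \<Sum>y\<in>\<Phi> i \<omega> \<inter> W. beta_kernel \<gamma> ((1 / h) *\<^sub>R (x\<^sub>0 - y)))"

definition mse :: "'m measure \<Rightarrow> ('m \<Rightarrow> real) \<Rightarrow> real \<Rightarrow> real" where
  "mse M T \<theta> = (LINT \<omega>|M. (T \<omega> - \<theta>)\<^sup>2)"

definition asymptotic_mse ::
    "'n::finite \<Rightarrow> real \<Rightarrow> (real ^ 'n \<Rightarrow> real) \<Rightarrow> real ^ 'n \<Rightarrow> nat \<Rightarrow> real \<Rightarrow> real" where
  "asymptotic_mse k \<gamma> l x\<^sub>0 n h =
     h ^ 4 * ((beta_V k \<gamma>)\<^sup>2 / 4) * (\<Sum>i\<in>UNIV. partial2 i i l x\<^sub>0)\<^sup>2 +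
     l x\<^sub>0 * beta_Q TYPE('n) \<gamma> / (real n * h ^ CARD('n))"

end

theory Submission
  imports Defs "HOL-Combinatorics.Transposition"
begin

text \<open>
  The estimator is an average of \<open>n\<close> independent copies of \<open>S = (\<Sum>y\<in>X \<inter> W. f y)\<close>, divided by \<open>h ^ d\<close>,
  where \<open>f y\<close> is the kernel at \<open>(x\<^sub>0 - y) / h\<close>. Its mean squared error is therefore
  \<open>Var S / (n h ^ (2 d)) + (E S / h ^ d - l x\<^sub>0)\<^sup>2\<close> (\<open>mse_scaled_mean\<close>), and both terms are governed by
  the first two moments of \<open>S\<close>.

  Writing \<open>S\<^sup>2\<close> as a sum over the diagonal plus a sum over distinct pairs gives
  \<open>Var S = A + P - (E S)\<^sup>2\<close> with \<open>A = \<integral>\<^sub>W f\<^sup>2 l\<close> and \<open>P\<close> the integral of \<open>f(u) f(v)\<close> against the second order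
  product density. If the pair correlation function is bounded by \<open>G\<close>, then \<open>0 \<le> P \<le> G (E S)\<^sup>2\<close>, so \<open>Var S\<close> is
  \<open>A\<close> up to \<open>(G + 1) (E S)\<^sup>2\<close> (\<open>config_sum_moments\<close>). After the substitution \<open>u = x\<^sub>0 - h z\<close> one has
  \<open>A = h ^ d (l x\<^sub>0 Q + O(h))\<close> and \<open>E S = O(h ^ d)\<close>; the error \<open>O(h ^ (2 d))\<close> is absorbed in
  \<open>O(h ^ (d + 1))\<close> because \<open>d \<ge> 1\<close> (\<open>variance_remainder\<close>).

  For the bias the same substitution gives \<open>E S / h ^ d = \<integral> \<kappa>(z) l(x\<^sub>0 - h z) dz\<close>. A second order Taylor
  expansion with Hoelder remainder leaves an error \<open>O(h powr (2 + \<alpha>))\<close>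
  (\<open>second_order_taylor_hoelder\<close>), and the invariance of the kernel under sign changes and
  permutations of coordinates removes the linear and the mixed terms and makes the pure second
  moments equal (\<open>integral_beta_kernel_second_order\<close>). Squaring gives the error
  \<open>O(h powr (4 + \<alpha>))\<close> (\<open>squared_bias_remainder\<close>).

  Finally, minimising \<open>a h ^ 4 + c / h ^ d\<close> is, in the variable \<open>s = ln (h / h\<^sub>*)\<close>, the inequality
  \<open>exp x > 1 + x\<close> for \<open>x \<noteq> 0\<close> applied at \<open>4 s\<close> and at \<open>- d s\<close>, weighted so that the linear terms
  cancel (\<open>is_arg_min_bandwidth\<close>).
\<close>

section \<open>Sums over the points of a point process\<close>

lemma measurable_config_card:
  assumes B: "B \<in> sets borel" "bounded B"
  shows "(\<lambda>S. card (S \<inter> B)) \<in> measurable config_space (count_space UNIV)"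
proof -
  have gen: "{{S \<in> configurations. card (S \<inter> B) = k} | B k. B \<in> sets borel \<and> bounded B}
      \<subseteq> Pow (configurations :: 'a set set)"
    by auto
  have sp: "space (config_space :: 'a set measure) = configurations"
    unfolding config_space_def using gen by (rule space_measure_of)
  have "(\<lambda>S. card (S \<inter> B)) -` {k} \<inter> space config_space \<in> sets config_space" for k
  proof -
    have "(\<lambda>S. card (S \<inter> B)) -` {k} \<inter> space config_space = {S \<in> configurations. card (S \<inter> B) = k}"
      unfolding sp by auto
    then show ?thesis
      using B unfolding config_space_def sets_measure_of[OF gen]
      by (auto intro!: sigma_sets.Basic)
  qed
  then show ?thesis
    by (subst measurable_count_space_eq2_countable) auto
qed

lemma space_config_space: "space config_space = configurations"
  unfolding config_space_def by (rule space_measure_of) auto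

lemma finite_config_inter:
  "S \<in> space config_space \<Longrightarrow> bounded W \<Longrightarrow> finite (S \<inter> W)"
  by (simp add: space_config_space configurations_def)

text \<open>The counts in bounded Borel sets generate the sigma-algebra, which is the indicator case; the
  general case follows by monotone approximation with simple functions.\<close>

lemma measurable_config_nn_integral:
  fixes f :: "'a::metric_space \<Rightarrow> ennreal"
  assumes f: "f \<in> borel_measurable borel" and W: "W \<in> sets borel" "bounded W"
  shows "(\<lambda>S. \<integral>\<^sup>+y. f y \<partial>count_space (S \<inter> W)) \<in> borel_measurable config_space"
  using f
proof (induction rule: borel_measurable_induct)
  case (cong f g)
  then show ?case by (simp add: cong)
next
  case (set B)
  have WB: "W \<inter> B \<in> sets borel" "bounded (W \<inter> B)"
    using set W by (auto intro: bounded_subset)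
  have "(\<lambda>S. of_nat (card (S \<inter> (W \<inter> B))) :: ennreal) \<in> borel_measurable config_space"
    using measurable_config_card[OF WB] by (rule measurable_compose) simp
  also have "?this \<longleftrightarrow> ?case"
  proof (rule measurable_cong)
    fix S :: "'a set" assume "S \<in> space config_space"
    then have "finite (S \<inter> W)" using W by (intro finite_config_inter)
    then have "emeasure (count_space (S \<inter> W)) (S \<inter> W \<inter> B) = card (S \<inter> W \<inter> B)"
      by (intro emeasure_count_space_finite) auto
    moreover have "(\<integral>\<^sup>+y. indicator B y \<partial>count_space (S \<inter> W))
        = emeasure (count_space (S \<inter> W)) (S \<inter> W \<inter> B)"
      by (subst nn_integral_indicator[symmetric]) (auto intro!: nn_integral_cong simp: indicator_def)
    ultimately show "of_nat (card (S \<inter> (W \<inter> B))) = (\<integral>\<^sup>+y. indicator B y \<partial>count_space (S \<inter> W))"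
      by (simp add: Int_assoc)
  qed
  finally show ?case .
next
  case (mult f c)
  then show ?case by (simp add: nn_integral_cmult)
next
  case (add f g)
  then show ?case by (simp add: nn_integral_add)
next
  case (seq U)
  have "(\<integral>\<^sup>+y. (SUP i. U i) y \<partial>count_space (S \<inter> W)) = (SUP i. \<integral>\<^sup>+y. U i y \<partial>count_space (S \<inter> W))" for S
    unfolding SUP_apply using seq by (intro nn_integral_monotone_convergence_SUP) auto
  then show ?case using seq by simp
qed

lemma nn_integral_count_space_ennreal:
  assumes "finite F" "\<And>y. y \<in> F \<Longrightarrow> 0 \<le> f y"
  shows "(\<integral>\<^sup>+y. ennreal (f y) \<partial>count_space F) = ennreal (\<Sum>y\<in>F. f y)"
  using assms by (simp add: nn_integral_count_space_finite sum_ennreal)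

lemma measurable_config_sum:
  fixes f :: "'a::metric_space \<Rightarrow> real"
  assumes f[measurable]: "f \<in> borel_measurable borel" and nn: "\<And>y. 0 \<le> f y"
    and W: "W \<in> sets borel" "bounded W"
  shows "(\<lambda>S. \<Sum>y\<in>S \<inter> W. f y) \<in> borel_measurable config_space"
proof -
  have "(\<lambda>S. enn2real (\<integral>\<^sup>+y. ennreal (f y) \<partial>count_space (S \<inter> W))) \<in> borel_measurable config_space"
    using measurable_config_nn_integral[OF _ W, of "\<lambda>y. ennreal (f y)"] by simp
  also have "?this \<longleftrightarrow> ?thesis"
    by (intro measurable_cong)
      (simp add: nn_integral_count_space_ennreal finite_config_inter[OF _ W(2)] nn sum_nonneg)
  finally show ?thesis .
qed

text \<open>Campbell's formula for real-valued sums. The weight \<open>indicator W u * l u\<close> is the intensity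
  extended by zero: a Borel function on the whole space, whereas \<open>l\<close> itself is only measurable
  on \<open>W\<close>.\<close>

lemma nn_integral_config_sum:
  fixes f :: "'a::euclidean_space \<Rightarrow> real"
  assumes X: "point_process M X" and W: "W \<in> sets borel" "bounded W"
    and l: "has_intensity_function M X W l"
    and f[measurable]: "f \<in> borel_measurable borel" and nn: "\<And>y. 0 \<le> f y"
  shows "(\<integral>\<^sup>+\<omega>. ennreal (\<Sum>y\<in>X \<omega> \<inter> W. f y) \<partial>M) = (\<integral>\<^sup>+u. ennreal (f u * (indicator W u * l u)) \<partial>lborel)"
proof -
  have "(\<integral>\<^sup>+\<omega>. ennreal (\<Sum>y\<in>X \<omega> \<inter> W. f y) \<partial>M)
      = (\<integral>\<^sup>+\<omega>. (\<integral>\<^sup>+y. ennreal (f y) \<partial>count_space (X \<omega> \<inter> W)) \<partial>M)"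
  proof (rule nn_integral_cong)
    fix \<omega> assume "\<omega> \<in> space M"
    then have "finite (X \<omega> \<inter> W)"
      using X W unfolding point_process_def by (intro finite_config_inter) (auto dest: measurable_space)
    then show "ennreal (\<Sum>y\<in>X \<omega> \<inter> W. f y) = (\<integral>\<^sup>+y. ennreal (f y) \<partial>count_space (X \<omega> \<inter> W))"
      by (simp add: nn_integral_count_space_ennreal nn)
  qed
  also have "\<dots> = (\<integral>\<^sup>+u\<in>W. (ennreal (f u) * ennreal (l u)) \<partial>lborel)"
    using l unfolding has_intensity_function_def by simp
  also have "\<dots> = (\<integral>\<^sup>+u. ennreal (f u * (indicator W u * l u)) \<partial>lborel)"
    by (intro nn_integral_cong) (auto simp: indicator_def ennreal_mult' nn)
  finally show ?thesis .
qed

lemma sum_square_distinct_pairs: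
  fixes f :: "'a \<Rightarrow> real"
  assumes "finite F"
  shows "(\<Sum>y\<in>F. f y)\<^sup>2 = (\<Sum>y\<in>F. (f y)\<^sup>2) + (\<Sum>p\<in>distinct_pairs F. f (fst p) * f (snd p))"
proof -
  have "(\<Sum>y\<in>F. f y)\<^sup>2 = (\<Sum>p\<in>F \<times> F. f (fst p) * f (snd p))"
    by (simp add: power2_eq_square sum_product sum.cartesian_product case_prod_beta)
  also have "F \<times> F = (\<lambda>y. (y, y)) ` F \<union> distinct_pairs F"
    by (auto simp: distinct_pairs_def)
  also have "(\<Sum>p\<in>\<dots>. f (fst p) * f (snd p))
      = (\<Sum>p\<in>(\<lambda>y. (y, y)) ` F. f (fst p) * f (snd p)) + (\<Sum>p\<in>distinct_pairs F. f (fst p) * f (snd p))"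
    using assms by (intro sum.union_disjoint)
      (auto simp: distinct_pairs_def intro: finite_subset[of _ "F \<times> F"])
  also have "(\<Sum>p\<in>(\<lambda>y. (y, y)) ` F. f (fst p) * f (snd p)) = (\<Sum>y\<in>F. (f y)\<^sup>2)"
    by (subst sum.reindex) (auto simp: inj_on_def power2_eq_square)
  finally show ?thesis .
qed

text \<open>The diagonal part of the squared sum is controlled by the intensity and the off-diagonal part by
  the product density.\<close>

lemma nn_integral_config_sum_square:
  fixes f :: "'a::euclidean_space \<Rightarrow> real"
  assumes X: "point_process M X" and W: "W \<in> sets borel" "bounded W"
    and l: "has_intensity_function M X W l" and r: "has_product_density2 M X W r"
    and f[measurable]: "f \<in> borel_measurable borel" and nn: "\<And>y. 0 \<le> f y"
  shows "(\<integral>\<^sup>+\<omega>. ennreal ((\<Sum>y\<in>X \<omega> \<inter> W. f y)\<^sup>2) \<partial>M)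
    = (\<integral>\<^sup>+u. ennreal ((f u)\<^sup>2 * (indicator W u * l u)) \<partial>lborel)
    + (\<integral>\<^sup>+p. ennreal (f (fst p) * f (snd p) * (indicator (W \<times> W) p * r p)) \<partial>lborel)"
proof -
  define D where "D \<omega> = (\<Sum>p\<in>distinct_pairs (X \<omega> \<inter> W). f (fst p) * f (snd p))" for \<omega>
  have X': "X \<in> measurable M config_space"
    using X by (simp add: point_process_def)
  have fin: "finite (X \<omega> \<inter> W)" if "\<omega> \<in> space M" for \<omega>
    using that measurable_space[OF X'] W by (intro finite_config_inter) auto
  have split: "(\<Sum>y\<in>X \<omega> \<inter> W. f y)\<^sup>2 = (\<Sum>y\<in>X \<omega> \<inter> W. (f y)\<^sup>2) + D \<omega>" if "\<omega> \<in> space M" for \<omega>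
    using sum_square_distinct_pairs[OF fin[OF that]] by (simp add: D_def)
  have [measurable]: "(\<lambda>\<omega>. \<Sum>y\<in>X \<omega> \<inter> W. f y) \<in> borel_measurable M"
    "(\<lambda>\<omega>. \<Sum>y\<in>X \<omega> \<inter> W. (f y)\<^sup>2) \<in> borel_measurable M"
    by (auto intro!: measurable_compose[OF X'] measurable_config_sum W nn)
  \<comment> \<open>The sum over distinct pairs inherits measurability as a difference of sums over points.\<close>
  have "(\<lambda>\<omega>. (\<Sum>y\<in>X \<omega> \<inter> W. f y)\<^sup>2 - (\<Sum>y\<in>X \<omega> \<inter> W. (f y)\<^sup>2)) \<in> borel_measurable M"
    by measurable
  also have "?this \<longleftrightarrow> D \<in> borel_measurable M"
    by (intro measurable_cong) (simp add: split)
  finally have [measurable]: "D \<in> borel_measurable M" .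
  have D_nn: "0 \<le> D \<omega>" for \<omega>
    by (auto simp: D_def intro!: sum_nonneg mult_nonneg_nonneg nn)
  have "(\<integral>\<^sup>+\<omega>. ennreal ((\<Sum>y\<in>X \<omega> \<inter> W. f y)\<^sup>2) \<partial>M)
      = (\<integral>\<^sup>+\<omega>. (ennreal (\<Sum>y\<in>X \<omega> \<inter> W. (f y)\<^sup>2) + ennreal (D \<omega>)) \<partial>M)"
    by (intro nn_integral_cong) (simp add: split D_nn sum_nonneg)
  also have "\<dots> = (\<integral>\<^sup>+\<omega>. ennreal (\<Sum>y\<in>X \<omega> \<inter> W. (f y)\<^sup>2) \<partial>M) + (\<integral>\<^sup>+\<omega>. ennreal (D \<omega>) \<partial>M)"
    by (intro nn_integral_add) measurable
  also have "(\<integral>\<^sup>+\<omega>. ennreal (\<Sum>y\<in>X \<omega> \<inter> W. (f y)\<^sup>2) \<partial>M)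
      = (\<integral>\<^sup>+u. ennreal ((f u)\<^sup>2 * (indicator W u * l u)) \<partial>lborel)"
    using nn_integral_config_sum[OF X W l, of "\<lambda>y. (f y)\<^sup>2"] by simp
  also have "(\<integral>\<^sup>+\<omega>. ennreal (D \<omega>) \<partial>M)
      = (\<integral>\<^sup>+\<omega>. (\<integral>\<^sup>+p. ennreal (f (fst p) * f (snd p)) \<partial>count_space (distinct_pairs (X \<omega> \<inter> W))) \<partial>M)"
  proof (rule nn_integral_cong)
    fix \<omega> assume "\<omega> \<in> space M"
    then have "finite (distinct_pairs (X \<omega> \<inter> W))"
      using fin[of \<omega>] by (auto simp: distinct_pairs_def intro: finite_subset[of _ "(X \<omega> \<inter> W) \<times> (X \<omega> \<inter> W)"])
    then show "ennreal (D \<omega>)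
        = (\<integral>\<^sup>+p. ennreal (f (fst p) * f (snd p)) \<partial>count_space (distinct_pairs (X \<omega> \<inter> W)))"
      by (simp add: D_def nn_integral_count_space_ennreal nn)
  qed
  also have "\<dots> = (\<integral>\<^sup>+p\<in>W \<times> W. (ennreal (f (fst p) * f (snd p)) * ennreal (r p)) \<partial>lborel)"
  proof -
    have "(\<lambda>p. ennreal (f (fst p) * f (snd p))) \<in> borel_measurable (borel :: ('a \<times> 'a) measure)"
      unfolding borel_prod[symmetric] by measurable
    then show ?thesis
      using r unfolding has_product_density2_def by blast
  qed
  also have "\<dots> = (\<integral>\<^sup>+p. ennreal (f (fst p) * f (snd p) * (indicator (W \<times> W) p * r p)) \<partial>lborel)"
    by (intro nn_integral_cong) (auto simp: indicator_def ennreal_mult'' ennreal_mult' nn)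
  finally show ?thesis .
qed

text \<open>A bound on the pair correlation function makes the pair integral comparable with the integral
  against the product of two copies of the intensity, which Tonelli factorises.\<close>

lemma pair_integral_le:
  fixes f :: "'a::euclidean_space \<Rightarrow> real"
  assumes W: "W \<in> sets borel" and l: "has_intensity_function M X W l"
    and r: "\<And>u v. u \<in> W \<Longrightarrow> v \<in> W \<Longrightarrow> r (u, v) \<le> G * (l u * l v)" and G: "0 \<le> G"
    and f[measurable]: "f \<in> borel_measurable borel" and nn: "\<And>y. 0 \<le> f y"
  shows "(\<integral>\<^sup>+p. ennreal (f (fst p) * f (snd p) * (indicator (W \<times> W) p * r p)) \<partial>lborel)
    \<le> ennreal G * (\<integral>\<^sup>+u. ennreal (f u * (indicator W u * l u)) \<partial>lborel)\<^sup>2"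
proof -
  have l_nn: "0 \<le> l u" if "u \<in> W" for u
    using l that by (auto simp: has_intensity_function_def)
  have lm: "l \<in> borel_measurable (restrict_space borel W)"
    using l by (auto simp: has_intensity_function_def)
  have [measurable]: "(\<lambda>u. indicator W u * l u) \<in> borel_measurable borel"
    using lm W by (subst (asm) borel_measurable_restrict_space_iff) (auto simp: mult.commute)
  define q where "q u = ennreal (f u * (indicator W u * l u))" for u
  have [measurable]: "q \<in> borel_measurable borel" unfolding q_def by measurable
  have "(\<integral>\<^sup>+p. ennreal (f (fst p) * f (snd p) * (indicator (W \<times> W) p * r p)) \<partial>lborel)
      \<le> (\<integral>\<^sup>+p. ennreal G * (q (fst p) * q (snd p)) \<partial>lborel)"
  proof (rule nn_integral_mono)
    fix p :: "'a \<times> 'a"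
    obtain u v where p: "p = (u, v)" by (cases p)
    show "ennreal (f (fst p) * f (snd p) * (indicator (W \<times> W) p * r p)) \<le> ennreal G * (q (fst p) * q (snd p))"
    proof (cases "u \<in> W \<and> v \<in> W")
      case True
      have "f u * f v * r (u, v) \<le> f u * f v * (G * (l u * l v))"
        using True r nn by (intro mult_left_mono) auto
      also have "\<dots> = G * ((f u * l u) * (f v * l v))"
        by (simp add: ac_simps)
      finally show ?thesis
        using True G nn l_nn by (simp add: p q_def ennreal_mult[symmetric] ennreal_leI)
    qed (auto simp: p indicator_def)
  qed
  also have "\<dots> = (\<integral>\<^sup>+p. ennreal G * (q (fst p) * q (snd p)) \<partial>(lborel \<Otimes>\<^sub>M lborel))"
    by (simp add: lborel_prod)
  also have "\<dots> = (\<integral>\<^sup>+u. \<integral>\<^sup>+v. ennreal G * (q u * q v) \<partial>lborel \<partial>lborel)"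
    by (subst lborel.nn_integral_fst[symmetric]) auto
  also have "\<dots> = ennreal G * (\<integral>\<^sup>+u. q u \<partial>lborel)\<^sup>2"
    by (simp add: nn_integral_cmult nn_integral_multc power2_eq_square)
  finally show ?thesis by (simp add: q_def)
qed

text \<open>The variance differs from its diagonal part by \<open>p - m\<^sup>2\<close>, where \<open>p\<close> is the pair
  integral. A pair correlation function with values in \<open>[0, G]\<close> forces \<open>0 \<le> p \<le> G * m\<^sup>2\<close>.
  For a kernel of bandwidth \<open>b\<close> in dimension \<open>d\<close> the diagonal part is of order \<open>b ^ d\<close> and
  \<open>m\<^sup>2\<close> is of order \<open>b ^ (2 * d)\<close>.\<close>

lemma (in prob_space) config_sum_moments:
  fixes f :: "'b::euclidean_space \<Rightarrow> real" and X :: "'a \<Rightarrow> 'b set"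
  assumes X: "point_process M X" and W: "W \<in> sets borel" "bounded W"
    and l: "has_intensity_function M X W l" and \<rho>: "has_product_density2 M X W r"
    and r: "\<And>u v. u \<in> W \<Longrightarrow> v \<in> W \<Longrightarrow> r (u, v) \<le> G * (l u * l v)" and G: "0 \<le> G"
    and f[measurable]: "f \<in> borel_measurable borel" and nn: "\<And>y. 0 \<le> f y" and K: "\<And>y. f y \<le> K"
  defines "S \<equiv> \<lambda>\<omega>. \<Sum>y\<in>X \<omega> \<inter> W. f y"
    and "m \<equiv> LINT u|lborel. f u * (indicator W u * l u)"
  shows "integrable M S" "integrable M (\<lambda>\<omega>. (S \<omega>)\<^sup>2)"
    "expectation S = m"
    "\<bar>variance S - (LINT u|lborel. (f u)\<^sup>2 * (indicator W u * l u))\<bar> \<le> (G + 1) * m\<^sup>2"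
proof -
  have X': "X \<in> measurable M config_space"
    using X by (simp add: point_process_def)
  have l_nn: "0 \<le> l u" if "u \<in> W" for u
    using l that by (auto simp: has_intensity_function_def)
  have lm: "l \<in> borel_measurable (restrict_space borel W)"
    using l by (auto simp: has_intensity_function_def)
  have L_meas[measurable]: "(\<lambda>u. indicator W u * l u) \<in> borel_measurable borel"
    using lm W by (subst (asm) borel_measurable_restrict_space_iff) (auto simp: mult.commute)
  have L_nn: "0 \<le> indicator W u * l u" for u
    using l_nn by (auto simp: indicator_def)
  have [measurable]: "S \<in> borel_measurable M"
    unfolding S_def by (auto intro!: measurable_compose[OF X'] measurable_config_sum W nn)
  have S_nn: "0 \<le> S \<omega>" for \<omega>
    by (auto simp: S_def intro!: sum_nonneg nn)

  \<comment> \<open>By Campbell's formula for the constant 1, local finiteness of the moment measure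
    makes the intensity integrable over \<open>W\<close>.\<close>
  have "(\<integral>\<^sup>+\<omega>. ennreal (\<Sum>y\<in>X \<omega> \<inter> W. 1) \<partial>M) = moment_measure M X W"
    unfolding moment_measure_def
  proof (rule nn_integral_cong)
    fix \<omega> assume "\<omega> \<in> space M"
    then have "finite (X \<omega> \<inter> W)"
      using measurable_space[OF X'] W by (intro finite_config_inter) auto
    then show "ennreal (\<Sum>y\<in>X \<omega> \<inter> W. 1) = emeasure (count_space UNIV) (X \<omega> \<inter> W)"
      by (simp add: ennreal_of_nat_eq_real_of_nat)
  qed
  also have "\<dots> < \<infinity>"
    using l W by (auto simp: has_intensity_function_def)
  finally have "(\<integral>\<^sup>+u. ennreal (indicator W u * l u) \<partial>lborel) < \<infinity>"
    using nn_integral_config_sum[OF X W l, of "\<lambda>_. 1"] by simp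
  then have L_int: "integrable lborel (\<lambda>u. indicator W u * l u)"
    by (intro integrableI_nonneg) (use L_nn in auto)
  have int: "integrable lborel (\<lambda>u. c u * (indicator W u * l u))"
    if [measurable]: "c \<in> borel_measurable borel" and "\<And>u. 0 \<le> c u" "\<And>u. c u \<le> B" for c and B :: real
  proof (rule Bochner_Integration.integrable_bound)
    show "integrable lborel (\<lambda>u. B * (indicator W u * l u))"
      using L_int by (rule integrable_mult_right)
    show "AE u in lborel. norm (c u * (indicator W u * l u)) \<le> norm (B * (indicator W u * l u))"
      using that by (intro AE_I2) (auto simp: abs_mult intro!: mult_right_mono order.trans[OF _ abs_ge_self])
  qed auto
  note int1 = int[OF f nn K]
  have int2: "integrable lborel (\<lambda>u. (f u)\<^sup>2 * (indicator W u * l u))"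
    by (rule int[of "\<lambda>u. (f u)\<^sup>2" "K\<^sup>2"]) (auto intro!: power_mono nn K)

  have m: "(\<integral>\<^sup>+u. ennreal (f u * (indicator W u * l u)) \<partial>lborel) = ennreal m"
    unfolding m_def by (intro nn_integral_eq_integral int1 AE_I2 mult_nonneg_nonneg nn L_nn)
  have m_nn: "0 \<le> m"
    unfolding m_def by (intro integral_nonneg_AE AE_I2 mult_nonneg_nonneg nn L_nn)
  have ES: "(\<integral>\<^sup>+\<omega>. ennreal (S \<omega>) \<partial>M) = ennreal m"
    unfolding S_def nn_integral_config_sum[OF X W l f nn] by (rule m)
  show S_int: "integrable M S"
    by (rule integrableI_nonneg) (auto simp: S_nn ES)
  show S_exp: "expectation S = m"
    using ES m_nn S_nn by (subst integral_eq_nn_integral) auto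

  define A where "A = (LINT u|lborel. (f u)\<^sup>2 * (indicator W u * l u))"
  have A: "(\<integral>\<^sup>+u. ennreal ((f u)\<^sup>2 * (indicator W u * l u)) \<partial>lborel) = ennreal A"
    unfolding A_def by (intro nn_integral_eq_integral int2 AE_I2 mult_nonneg_nonneg L_nn) auto
  have A_nn: "0 \<le> A"
    unfolding A_def by (intro integral_nonneg_AE AE_I2 mult_nonneg_nonneg L_nn) auto
  define P where "P = (\<integral>\<^sup>+p. ennreal (f (fst p) * f (snd p) * (indicator (W \<times> W) p * r p)) \<partial>lborel)"
  have P_le: "P \<le> ennreal (G * m\<^sup>2)"
    using pair_integral_le[OF W(1) l r G f nn] G m_nn
    unfolding P_def m by (simp add: ennreal_mult ennreal_power)
  then have P_fin: "P < \<infinity>"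
    by (rule order.strict_trans1) simp
  then obtain p where p: "P = ennreal p" "0 \<le> p"
    by (cases P) auto
  have p_le: "p \<le> G * m\<^sup>2"
    using P_le p G m_nn by (simp add: ennreal_le_iff)
  have ES2: "(\<integral>\<^sup>+\<omega>. ennreal ((S \<omega>)\<^sup>2) \<partial>M) = ennreal (A + p)"
    unfolding S_def nn_integral_config_sum_square[OF X W l \<rho> f nn] A P_def[symmetric] p
    using A_nn p by simp
  show S2_int: "integrable M (\<lambda>\<omega>. (S \<omega>)\<^sup>2)"
    by (rule integrableI_nonneg) (auto simp: ES2)
  have "expectation (\<lambda>\<omega>. (S \<omega>)\<^sup>2) = A + p"
    using ES2 A_nn p by (subst integral_eq_nn_integral) (auto simp del: ennreal_plus)
  then have "variance S = A + p - m\<^sup>2"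
    using S_int S2_int by (simp add: variance_eq flip: S_exp)
  then have "variance S - A = p - m\<^sup>2" by simp
  moreover have "\<bar>p - m\<^sup>2\<bar> \<le> (G + 1) * m\<^sup>2"
    using p p_le G by (simp add: algebra_simps abs_le_iff) (smt (verit) mult_nonneg_nonneg zero_le_power2)
  ultimately show "\<bar>variance S - (LINT u|lborel. (f u)\<^sup>2 * (indicator W u * l u))\<bar> \<le> (G + 1) * m\<^sup>2"
    by (simp add: A_def)
qed

section \<open>Mean squared error of an average of independent variables\<close>

text \<open>Bienayme's identity: the cross terms vanish by independence and centring.\<close>

lemma (in prob_space) expectation_square_sum_centred:
  fixes Z :: "nat \<Rightarrow> 'a \<Rightarrow> real"
  assumes indep: "indep_vars (\<lambda>_. borel) Z I" and I: "finite I"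
    and int: "\<And>i. i \<in> I \<Longrightarrow> integrable M (Z i)"
    and int2: "\<And>i. i \<in> I \<Longrightarrow> integrable M (\<lambda>\<omega>. (Z i \<omega>)\<^sup>2)"
    and mean: "\<And>i. i \<in> I \<Longrightarrow> expectation (Z i) = 0"
  shows "integrable M (\<lambda>\<omega>. (\<Sum>i\<in>I. Z i \<omega>)\<^sup>2)"
    and "expectation (\<lambda>\<omega>. (\<Sum>i\<in>I. Z i \<omega>)\<^sup>2) = (\<Sum>i\<in>I. expectation (\<lambda>\<omega>. (Z i \<omega>)\<^sup>2))"
proof -
  have cross: "integrable M (\<lambda>\<omega>. Z i \<omega> * Z j \<omega>) \<and>
      expectation (\<lambda>\<omega>. Z i \<omega> * Z j \<omega>) = (if i = j then expectation (\<lambda>\<omega>. (Z i \<omega>)\<^sup>2) else 0)"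
    if ij: "i \<in> I" "j \<in> I" for i j
  proof (cases "i = j")
    case True
    then show ?thesis using int2[OF ij(1)] by (simp add: power2_eq_square)
  next
    case False
    have "indep_vars (\<lambda>_. borel) Z {i, j}"
      using indep by (rule indep_vars_subset) (use ij in auto)
    then have "integrable M (\<lambda>\<omega>. \<Prod>k\<in>{i, j}. Z k \<omega>)"
      "expectation (\<lambda>\<omega>. \<Prod>k\<in>{i, j}. Z k \<omega>) = (\<Prod>k\<in>{i, j}. expectation (Z k))"
      using int ij by (auto intro!: indep_vars_integrable indep_vars_lebesgue_integral)
    then show ?thesis using False mean ij by simp
  qed
  have sq: "(\<Sum>i\<in>I. Z i \<omega>)\<^sup>2 = (\<Sum>i\<in>I. \<Sum>j\<in>I. Z i \<omega> * Z j \<omega>)" for \<omega>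
    by (simp add: power2_eq_square sum_product)
  show "integrable M (\<lambda>\<omega>. (\<Sum>i\<in>I. Z i \<omega>)\<^sup>2)"
    unfolding sq using cross by (intro Bochner_Integration.integrable_sum) auto
  have "expectation (\<lambda>\<omega>. (\<Sum>i\<in>I. Z i \<omega>)\<^sup>2) = (\<Sum>i\<in>I. \<Sum>j\<in>I. expectation (\<lambda>\<omega>. Z i \<omega> * Z j \<omega>))"
    unfolding sq using cross by (simp add: Bochner_Integration.integral_sum)
  also have "\<dots> = (\<Sum>i\<in>I. \<Sum>j\<in>I. if i = j then expectation (\<lambda>\<omega>. (Z i \<omega>)\<^sup>2) else 0)"
    using cross by (intro sum.cong) auto
  also have "\<dots> = (\<Sum>i\<in>I. expectation (\<lambda>\<omega>. (Z i \<omega>)\<^sup>2))"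
    using I by simp
  finally show "expectation (\<lambda>\<omega>. (\<Sum>i\<in>I. Z i \<omega>)\<^sup>2) = (\<Sum>i\<in>I. expectation (\<lambda>\<omega>. (Z i \<omega>)\<^sup>2))" .
qed

text \<open>The decomposition into variance and squared bias.\<close>

lemma (in prob_space) mse_scaled_mean:
  fixes Y :: "nat \<Rightarrow> 'a \<Rightarrow> real"
  assumes indep: "indep_vars (\<lambda>_. borel) Y {1..n}" and n: "1 \<le> n" and c: "0 < c"
    and int: "\<And>i. i \<in> {1..n} \<Longrightarrow> integrable M (Y i)"
    and int2: "\<And>i. i \<in> {1..n} \<Longrightarrow> integrable M (\<lambda>\<omega>. (Y i \<omega>)\<^sup>2)"
    and mean: "\<And>i. i \<in> {1..n} \<Longrightarrow> expectation (Y i) = m"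
    and var: "\<And>i. i \<in> {1..n} \<Longrightarrow> variance (Y i) = v"
  shows "integrable M (\<lambda>\<omega>. (1 / (real n * c) * (\<Sum>i=1..n. Y i \<omega>) - \<theta>)\<^sup>2)"
    and "mse M (\<lambda>\<omega>. 1 / (real n * c) * (\<Sum>i=1..n. Y i \<omega>)) \<theta> = v / (real n * c\<^sup>2) + (m / c - \<theta>)\<^sup>2"
proof -
  define Z where "Z i \<omega> = Y i \<omega> - m" for i \<omega>
  define b where "b = m / c - \<theta>"
  have "indep_vars (\<lambda>_. borel) (\<lambda>i \<omega>. Y i \<omega> - m) {1..n}"
    using indep by (rule indep_vars_compose2) auto
  then have Z_indep: "indep_vars (\<lambda>_. borel) Z {1..n}"
    by (simp add: Z_def[abs_def])
  have Z_int: "integrable M (Z i)" "integrable M (\<lambda>\<omega>. (Z i \<omega>)\<^sup>2)"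
      "expectation (Z i) = 0" "expectation (\<lambda>\<omega>. (Z i \<omega>)\<^sup>2) = v" if "i \<in> {1..n}" for i
    using int[OF that] int2[OF that] mean[OF that] var[OF that]
    by (simp_all add: Z_def[abs_def] power2_diff prob_space)
  note Z_sum = expectation_square_sum_centred[OF Z_indep finite_atLeastAtMost Z_int(1-3)]
  have *: "(1 / (real n * c) * (\<Sum>i=1..n. Y i \<omega>) - \<theta>)\<^sup>2
      = 1 / (real n * c)\<^sup>2 * (\<Sum>i=1..n. Z i \<omega>)\<^sup>2 + 2 * b / (real n * c) * (\<Sum>i=1..n. Z i \<omega>) + b\<^sup>2" for \<omega>
  proof -
    have "(\<Sum>i=1..n. Y i \<omega>) = (\<Sum>i=1..n. Z i \<omega>) + real n * m"
      by (simp add: Z_def sum_subtractf)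
    then have "1 / (real n * c) * (\<Sum>i=1..n. Y i \<omega>) - \<theta> = 1 / (real n * c) * (\<Sum>i=1..n. Z i \<omega>) + b"
      using n c by (simp add: b_def field_simps)
    then show ?thesis
      by (simp only: power2_sum power_mult_distrib power_one_over) simp
  qed
  have int_lin: "integrable M (\<lambda>\<omega>. \<Sum>i=1..n. Z i \<omega>)"
    using Z_int(1) by (intro Bochner_Integration.integrable_sum) auto
  show "integrable M (\<lambda>\<omega>. (1 / (real n * c) * (\<Sum>i=1..n. Y i \<omega>) - \<theta>)\<^sup>2)"
    unfolding * using Z_sum(1) int_lin
    by (intro Bochner_Integration.integrable_add integrable_mult_right) auto
  have "mse M (\<lambda>\<omega>. 1 / (real n * c) * (\<Sum>i=1..n. Y i \<omega>)) \<theta>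
      = 1 / (real n * c)\<^sup>2 * expectation (\<lambda>\<omega>. (\<Sum>i=1..n. Z i \<omega>)\<^sup>2)
        + 2 * b / (real n * c) * expectation (\<lambda>\<omega>. \<Sum>i=1..n. Z i \<omega>) + b\<^sup>2"
    unfolding mse_def * using Z_sum(1) int_lin
    by (subst Bochner_Integration.integral_add | simp add: prob_space)+
  also have "expectation (\<lambda>\<omega>. \<Sum>i=1..n. Z i \<omega>) = 0"
    using Z_int by (subst Bochner_Integration.integral_sum) auto
  also have "expectation (\<lambda>\<omega>. (\<Sum>i=1..n. Z i \<omega>)\<^sup>2) = n * v"
    using Z_sum(2) Z_int(4) by simp
  also have "1 / (real n * c)\<^sup>2 * (real n * v) + 2 * b / (real n * c) * 0 + b\<^sup>2 = v / (real n * c\<^sup>2) + b\<^sup>2"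
    using n c by (simp add: power2_eq_square)
  finally show "mse M (\<lambda>\<omega>. 1 / (real n * c) * (\<Sum>i=1..n. Y i \<omega>)) \<theta> = v / (real n * c\<^sup>2) + (m / c - \<theta>)\<^sup>2"
    by (simp add: b_def)
qed

section \<open>Invariance, positivity and scaling for Lebesgue measure\<close>

lemma prod_Basis_vec:
  fixes x :: "real ^ 'n::finite"
  shows "(\<Prod>b\<in>Basis. x \<bullet> b) = (\<Prod>i\<in>UNIV. x $ i)"
proof -
  have "bij_betw (\<lambda>i. axis i 1) UNIV (Basis :: (real ^ 'n) set)"
    by (auto simp: bij_betw_def inj_on_def axis_eq_axis Basis_vec_def)
  from prod.reindex_bij_betw[OF this, of "\<lambda>b. x \<bullet> b"] show ?thesis
    by (simp add: inner_axis)
qed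

text \<open>A signed coordinate permutation maps boxes to boxes with the same side lengths up to order, and
  boxes determine Lebesgue measure.\<close>

lemma lborel_distr_signed_permutation:
  fixes T :: "real ^ 'n::finite \<Rightarrow> real ^ 'n"
  assumes p: "bij p" and s: "\<And>i. s i = 1 \<or> s i = (-1::real)"
    and T: "\<And>x i. T x $ i = s i * x $ p i"
  shows "distr lborel borel T = lborel"
proof (rule lborel_eqI[symmetric])
  have "T = (\<lambda>x. \<chi> i. s i * x $ p i)"
    by (simp add: fun_eq_iff vec_eq_iff T)
  then have [measurable]: "T \<in> borel_measurable borel"
    by (auto intro!: borel_measurable_continuous_onI continuous_intros)
  fix l u :: "real ^ 'n" assume "\<And>b. b \<in> Basis \<Longrightarrow> l \<bullet> b \<le> u \<bullet> b"
  then have le: "l $ i \<le> u $ i" for i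
    by (metis axis_in_Basis_iff inner_axis' mult_1 inner_commute singletonI Basis_real_def inner_real_def)
  define q where "q = inv p"
  have q: "p (q i) = i" "q (p i) = i" for i
    using p by (simp_all add: q_def bij_is_surj bij_is_inj surj_f_inv_f)
  \<comment> \<open>A sign change at a coordinate interchanges the two ends of the interval there.\<close>
  define l' :: "real ^ 'n" where "l' = (\<chi> i. if s (q i) = 1 then l $ q i else - u $ q i)"
  define u' :: "real ^ 'n" where "u' = (\<chi> i. if s (q i) = 1 then u $ q i else - l $ q i)"
  have "T -` box l u = box l' u'"
  proof (rule set_eqI)
    fix x
    have *: "l $ i < s i * x $ p i \<and> s i * x $ p i < u $ i \<longleftrightarrow> l' $ p i < x $ p i \<and> x $ p i < u' $ p i" for i
      using s[of i] by (auto simp: l'_def u'_def q)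
    have "x \<in> T -` box l u \<longleftrightarrow> (\<forall>i. l' $ p i < x $ p i \<and> x $ p i < u' $ p i)"
      by (simp add: mem_box_cart T *)
    also have "\<dots> \<longleftrightarrow> x \<in> box l' u'"
      unfolding mem_box_cart by (metis q(1))
    finally show "x \<in> T -` box l u \<longleftrightarrow> x \<in> box l' u'" .
  qed
  moreover have "emeasure lborel (box l' u') = (\<Prod>b\<in>Basis. (u - l) \<bullet> b)"
  proof -
    have le': "l' \<bullet> b \<le> u' \<bullet> b" if "b \<in> Basis" for b
      using that le by (auto simp: Basis_vec_def inner_axis l'_def u'_def)
    have "(\<Prod>i\<in>UNIV. (u' - l') $ i) = (\<Prod>i\<in>UNIV. (u - l) $ q i)"
      by (intro prod.cong) (auto simp: l'_def u'_def)
    also have "\<dots> = (\<Prod>i\<in>UNIV. (u - l) $ i)"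
      using p by (intro prod.reindex_bij_betw) (simp add: q_def bij_imp_bij_inv)
    finally show ?thesis
      using le' by (simp add: prod_Basis_vec)
  qed
  ultimately show "emeasure (distr lborel borel T) (box l u) = (\<Prod>b\<in>Basis. (u - l) \<bullet> b)"
    by (simp add: emeasure_distr)
qed simp

text \<open>A nonempty open set is not a null set.\<close>

lemma integral_lborel_pos:
  fixes f :: "'a::euclidean_space \<Rightarrow> real"
  assumes f: "integrable lborel f" "\<And>x. 0 \<le> f x"
    and U: "open U" "U \<noteq> {}" "\<And>x. x \<in> U \<Longrightarrow> 0 < f x"
  shows "0 < (LINT x|lborel. f x)"
proof (rule ccontr)
  assume "\<not> ?thesis"
  moreover have "0 \<le> (LINT x|lborel. f x)" using f by simp
  ultimately have "(LINT x|lborel. f x) = 0" by linarith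
  then have "AE x in lborel. f x = 0"
    using integral_nonneg_eq_0_iff_AE[OF f(1)] f(2) by simp
  then have "AE x in lborel. x \<notin> U"
    by (rule eventually_mono) (use U(3) in force)
  then have "U \<in> null_sets lborel"
    using U(1) by (subst AE_iff_null_sets) auto
  then have "negligible U"
    by (simp add: negligible_iff_null_sets null_sets_completionI)
  then show False
    using U open_not_negligible by blast
qed

text \<open>The substitution \<open>u = x - h *\<^sub>R z\<close>, whose Jacobian has absolute value \<open>h ^ DIM('a)\<close>.\<close>

lemma lborel_integral_rescale:
  fixes F \<phi> :: "'a::euclidean_space \<Rightarrow> real"
  assumes [measurable]: "F \<in> borel_measurable borel" "\<phi> \<in> borel_measurable borel" and h: "0 < h"
  shows "(LINT u|lborel. F ((1 / h) *\<^sub>R (x - u)) * \<phi> u)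
    = h ^ DIM('a) * (LINT z|lborel. F z * \<phi> (x - h *\<^sub>R z))"
proof -
  have "(LINT u|lborel. F ((1 / h) *\<^sub>R (x - u)) * \<phi> u)
      = (LINT u|density (distr lborel borel (\<lambda>z. x + (- h) *\<^sub>R z)) (\<lambda>_. \<bar>- h\<bar> ^ DIM('a)).
          F ((1 / h) *\<^sub>R (x - u)) * \<phi> u)"
    by (rule arg_cong[OF lborel_affine]) (use h in simp)
  also have "\<dots> = (LINT z|lborel. h ^ DIM('a) * (F z * \<phi> (x - h *\<^sub>R z)))"
    using h by (subst integral_density) (auto simp: integral_distr)
  finally show ?thesis by simp
qed

section \<open>Moments of the Beta kernel\<close>

lemma measurable_rpow [measurable]:
  "f \<in> borel_measurable M \<Longrightarrow> (\<lambda>x. rpow (f x) \<gamma>) \<in> borel_measurable M"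
  by (cases "\<gamma> = 0") (simp_all add: rpow_def)

lemma cball_borel [measurable]: "cball x r \<in> sets borel" for x :: "'a::euclidean_space"
  by (simp add: borel_closed)

lemma rpow_nonneg: "0 \<le> rpow t \<gamma>"
  by (simp add: rpow_def)

lemma rpow_le_one: "0 \<le> t \<Longrightarrow> t \<le> 1 \<Longrightarrow> 0 \<le> \<gamma> \<Longrightarrow> rpow t \<gamma> \<le> 1"
  by (simp add: rpow_def powr_le1)

lemma rpow_pos: "0 < t \<Longrightarrow> 0 < rpow t \<gamma>"
  by (simp add: rpow_def)

lemma inner_self_le_one: "x \<in> cball 0 1 \<Longrightarrow> x \<bullet> x \<le> 1" for x :: "'a::real_inner"
  using abs_square_le_1[of "norm x"] by (simp add: power2_norm_eq_inner)

lemma inner_self_less_one: "x \<in> ball 0 1 \<Longrightarrow> x \<bullet> x < 1" for x :: "'a::real_inner"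
  using abs_square_less_1[of "norm x"] by (simp add: power2_norm_eq_inner)

lemma integrable_bounded_unit_ball:
  fixes f :: "'a::euclidean_space \<Rightarrow> real"
  assumes "f \<in> borel_measurable borel" and le: "\<And>x. \<bar>f x\<bar> \<le> K * indicator (cball 0 1) x"
  shows "integrable lborel f"
proof (rule Bochner_Integration.integrable_bound)
  show "integrable lborel (\<lambda>x::'a. K * indicator (cball 0 1) x)"
    using emeasure_bounded_finite[of "cball (0::'a) 1"]
    by (intro integrable_mult_right integrable_real_indicator) auto
  show "AE x in lborel. norm (f x) \<le> norm (K * indicator (cball 0 1) x)"
    by (intro AE_I2) (use le in \<open>force intro: order.trans[OF _ abs_ge_self]\<close>)
qed (use assms in auto)

lemma integrable_rpow_unit_ball:
  assumes "0 \<le> \<gamma>"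
  shows "integrable lborel (\<lambda>x :: real ^ 'n::finite. indicator (cball 0 1) x * rpow (1 - x \<bullet> x) \<gamma>)"
proof (rule integrable_bounded_unit_ball[where K = 1])
  show "\<bar>indicator (cball 0 1) x * rpow (1 - x \<bullet> x) \<gamma>\<bar> \<le> 1 * indicator (cball 0 1) x" for x :: "real ^ 'n"
    using rpow_le_one[of "1 - x \<bullet> x" \<gamma>] inner_self_le_one[of x] assms
    by (auto simp: indicator_def rpow_nonneg)
qed measurable

lemma beta_c_pos:
  assumes "0 \<le> \<gamma>"
  shows "0 < beta_c TYPE('n::finite) \<gamma>"
  unfolding beta_c_def set_lebesgue_integral_def real_scaleR_def
proof (rule integral_lborel_pos[where U = "ball 0 1"])
  show "integrable lborel (\<lambda>x :: real ^ 'n. indicator (cball 0 1) x * rpow (1 - x \<bullet> x) \<gamma>)"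
    using assms by (rule integrable_rpow_unit_ball)
  show "0 < indicator (cball 0 1) x * rpow (1 - x \<bullet> x) \<gamma>" if "x \<in> ball 0 1" for x :: "real ^ 'n"
    using inner_self_less_one[OF that] that rpow_pos[of "1 - x \<bullet> x" \<gamma>] by simp
qed (auto simp: rpow_nonneg)

lemma measurable_beta_kernel [measurable]:
  "beta_kernel \<gamma> \<in> borel_measurable (borel :: (real ^ 'n::finite) measure)"
  unfolding beta_kernel_def[abs_def] by measurable

lemma beta_kernel_nonneg: "0 \<le> \<gamma> \<Longrightarrow> 0 \<le> beta_kernel \<gamma> (x :: real ^ 'n::finite)"
  using beta_c_pos[of \<gamma>, where 'n = 'n] by (simp add: beta_kernel_def rpow_nonneg)

lemma beta_kernel_le:
  fixes x :: "real ^ 'n::finite"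
  assumes "0 \<le> \<gamma>"
  shows "beta_kernel \<gamma> x \<le> inverse (beta_c TYPE('n) \<gamma>) * indicator (cball 0 1) x"
  using beta_c_pos[OF assms, where 'n = 'n] rpow_le_one[of "1 - x \<bullet> x" \<gamma>] inner_self_le_one[of x] assms
  by (auto simp: beta_kernel_def indicator_def)

lemma beta_kernel_pos:
  fixes x :: "real ^ 'n::finite"
  assumes "0 \<le> \<gamma>" "x \<in> ball 0 1"
  shows "0 < beta_kernel \<gamma> x"
  using beta_c_pos[OF assms(1), where 'n = 'n] rpow_pos[of "1 - x \<bullet> x" \<gamma>] inner_self_less_one[OF assms(2)] assms(2)
  by (simp add: beta_kernel_def)

lemma beta_kernel_outside: "x \<notin> cball 0 1 \<Longrightarrow> beta_kernel \<gamma> x = 0"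
  by (simp add: beta_kernel_def)

lemma integrable_beta_kernel_mult:
  fixes \<phi> :: "real ^ 'n::finite \<Rightarrow> real"
  assumes \<gamma>: "0 \<le> \<gamma>" and [measurable]: "\<phi> \<in> borel_measurable borel"
    and B: "\<And>x. x \<in> cball 0 1 \<Longrightarrow> \<bar>\<phi> x\<bar> \<le> B"
  shows "integrable lborel (\<lambda>x. beta_kernel \<gamma> x * \<phi> x)"
    and "integrable lborel (\<lambda>x. (beta_kernel \<gamma> x)\<^sup>2 * \<phi> x)"
proof -
  define c where "c = inverse (beta_c TYPE('n) \<gamma>)"
  have le: "\<bar>beta_kernel \<gamma> x\<bar> \<le> c" for x :: "real ^ 'n"
    using beta_kernel_le[OF \<gamma>, of x] beta_kernel_nonneg[OF \<gamma>, of x] beta_c_pos[OF \<gamma>, where 'n = 'n]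
    by (cases "x \<in> cball 0 1") (auto simp: c_def)
  show "integrable lborel (\<lambda>x. beta_kernel \<gamma> x * \<phi> x)"
  proof (rule integrable_bounded_unit_ball[where K = "c * B"])
    show "\<bar>beta_kernel \<gamma> x * \<phi> x\<bar> \<le> c * B * indicator (cball 0 1) x" for x
      using mult_mono'[OF le[of x] B[of x]]
      by (cases "x \<in> cball 0 1") (auto simp: abs_mult beta_kernel_outside)
  qed measurable
  show "integrable lborel (\<lambda>x. (beta_kernel \<gamma> x)\<^sup>2 * \<phi> x)"
  proof (rule integrable_bounded_unit_ball[where K = "c\<^sup>2 * B"])
    have "\<bar>beta_kernel \<gamma> x\<bar>\<^sup>2 \<le> c\<^sup>2" for x :: "real ^ 'n"
      using le[of x] by (intro power_mono) auto
    from mult_mono'[OF this B]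
    show "\<bar>(beta_kernel \<gamma> x)\<^sup>2 * \<phi> x\<bar> \<le> c\<^sup>2 * B * indicator (cball 0 1) x" for x
      by (cases "x \<in> cball 0 1") (auto simp: abs_mult beta_kernel_outside)
  qed measurable
qed

lemma integral_beta_kernel:
  assumes "0 \<le> \<gamma>"
  shows "(LINT x|lborel. beta_kernel \<gamma> (x :: real ^ 'n::finite)) = 1"
proof -
  have "(LINT x|lborel. beta_kernel \<gamma> (x :: real ^ 'n))
      = (LINT x :: real ^ 'n|lborel. inverse (beta_c TYPE('n) \<gamma>)
          * (indicator (cball 0 1) x * rpow (1 - x \<bullet> x) \<gamma>))"
    by (simp add: beta_kernel_def mult_ac)
  also have "\<dots> = inverse (beta_c TYPE('n) \<gamma>) * beta_c TYPE('n) \<gamma>"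
    unfolding integral_mult_right_zero by (simp add: beta_c_def set_lebesgue_integral_def)
  finally show ?thesis
    using beta_c_pos[OF assms, where 'n = 'n] by simp
qed

lemma beta_Q_pos:
  assumes "0 \<le> \<gamma>"
  shows "0 < beta_Q TYPE('n::finite) \<gamma>"
  unfolding beta_Q_def
proof (rule integral_lborel_pos[where U = "ball 0 1"])
  show "integrable lborel (\<lambda>x :: real ^ 'n. (beta_kernel \<gamma> x)\<^sup>2)"
    using integrable_beta_kernel_mult(2)[OF assms, of "\<lambda>_. 1" 1] by simp
  show "0 < (beta_kernel \<gamma> x)\<^sup>2" if "x \<in> ball 0 1" for x :: "real ^ 'n"
    using beta_kernel_pos[OF assms that] by simp
qed auto

lemma component_abs_le_one: "x \<in> cball 0 1 \<Longrightarrow> \<bar>x $ i\<bar> \<le> 1" for x :: "real ^ 'n::finite"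
  using component_le_norm_cart[of x i] by simp

lemma integrable_beta_kernel_monomials:
  assumes "0 \<le> \<gamma>"
  shows "integrable lborel (\<lambda>x :: real ^ 'n::finite. beta_kernel \<gamma> x)"
    and "integrable lborel (\<lambda>x :: real ^ 'n. beta_kernel \<gamma> x * x $ i)"
    and "integrable lborel (\<lambda>x :: real ^ 'n. beta_kernel \<gamma> x * (x $ i * x $ j))"
proof -
  show "integrable lborel (\<lambda>x :: real ^ 'n. beta_kernel \<gamma> x)"
    using integrable_beta_kernel_mult(1)[OF assms, of "\<lambda>_. 1" 1] by simp
  show "integrable lborel (\<lambda>x :: real ^ 'n. beta_kernel \<gamma> x * x $ i)"
    by (rule integrable_beta_kernel_mult(1)[OF assms, where B = 1]) (simp_all add: component_abs_le_one)
  show "integrable lborel (\<lambda>x :: real ^ 'n. beta_kernel \<gamma> x * (x $ i * x $ j))"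
  proof (rule integrable_beta_kernel_mult(1)[OF assms, where B = 1])
    show "\<bar>x $ i * x $ j\<bar> \<le> 1" if "x \<in> cball 0 1" for x :: "real ^ 'n"
      using component_abs_le_one[OF that, of i] component_abs_le_one[OF that, of j]
      by (simp add: abs_mult mult_le_one)
  qed simp
qed

text \<open>The kernel depends on \<open>x\<close> through \<open>x \<bullet> x\<close>, which signed permutations preserve.\<close>

lemma integral_beta_kernel_signed_permutation:
  fixes T :: "real ^ 'n::finite \<Rightarrow> real ^ 'n" and \<phi> :: "real ^ 'n \<Rightarrow> real"
  assumes p: "bij p" and s: "\<And>i. s i = 1 \<or> s i = (-1::real)"
    and T: "\<And>x i. T x $ i = s i * x $ p i" and [measurable]: "\<phi> \<in> borel_measurable borel"
  shows "(LINT x|lborel. beta_kernel \<gamma> x * \<phi> (T x)) = (LINT x|lborel. beta_kernel \<gamma> x * \<phi> x)"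
proof -
  have "T = (\<lambda>x. \<chi> i. s i * x $ p i)"
    by (simp add: fun_eq_iff vec_eq_iff T)
  then have [measurable]: "T \<in> borel_measurable borel"
    by (auto intro!: borel_measurable_continuous_onI continuous_intros)
  have inner: "T x \<bullet> T x = x \<bullet> x" for x
  proof -
    have "T x $ i * T x $ i = x $ p i * x $ p i" for i
      using s[of i] by (auto simp: T)
    then have "T x \<bullet> T x = (\<Sum>i\<in>UNIV. x $ p i * x $ p i)"
      by (simp add: inner_vec_def)
    also have "\<dots> = x \<bullet> x"
      using sum.reindex_bij_betw[OF p, of "\<lambda>i. x $ i * x $ i"] by (simp add: inner_vec_def)
    finally show ?thesis .
  qed
  have K: "beta_kernel \<gamma> (T x) = beta_kernel \<gamma> x" for x
    using inner[of x] by (simp add: beta_kernel_def indicator_def norm_eq_sqrt_inner)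
  have "(LINT x|lborel. beta_kernel \<gamma> x * \<phi> x) = (LINT x|distr lborel borel T. beta_kernel \<gamma> x * \<phi> x)"
    by (simp add: lborel_distr_signed_permutation[OF p s T])
  also have "\<dots> = (LINT x|lborel. beta_kernel \<gamma> x * \<phi> (T x))"
    by (subst integral_distr) (auto simp: K)
  finally show ?thesis by simp
qed

text \<open>Reflecting one coordinate preserves the integral and changes its sign.\<close>

lemma integral_beta_kernel_odd:
  fixes \<phi> :: "real ^ 'n::finite \<Rightarrow> real"
  assumes [measurable]: "\<phi> \<in> borel_measurable borel"
    and odd: "\<And>x. \<phi> (\<chi> j. if j = i then - x $ j else x $ j) = - \<phi> x"
  shows "(LINT x|lborel. beta_kernel \<gamma> x * \<phi> x) = 0"
proof -
  have "(LINT x|lborel. beta_kernel \<gamma> x * \<phi> x)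
      = (LINT x|lborel. beta_kernel \<gamma> x * \<phi> (\<chi> j. if j = i then - x $ j else x $ j))"
    by (rule integral_beta_kernel_signed_permutation[of id "\<lambda>j. if j = i then -1 else 1", symmetric]) auto
  then show ?thesis
    by (simp add: odd)
qed

lemma integral_beta_kernel_linear: "(LINT x|lborel. beta_kernel \<gamma> x * x $ i) = 0"
  for i :: "'n::finite"
  by (rule integral_beta_kernel_odd[where i = i]) auto

text \<open>Exchanging two coordinates shows that the second moment does not depend on the coordinate, so
  that one constant \<open>beta_V k \<gamma>\<close> serves for all of them.\<close>

lemma integral_beta_kernel_square: "(LINT x|lborel. beta_kernel \<gamma> x * (x $ i * x $ i)) = beta_V k \<gamma>"
  for i k :: "'n::finite"
proof -
  have "(LINT x|lborel. beta_kernel \<gamma> x * ((\<chi> j. x $ Transposition.transpose i k j) $ i)\<^sup>2)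
      = (LINT x|lborel. beta_kernel \<gamma> x * (x $ i)\<^sup>2)"
    by (rule integral_beta_kernel_signed_permutation[of "Transposition.transpose i k" "\<lambda>_. 1"]) auto
  then show ?thesis
    by (simp add: beta_V_def mult.commute power2_eq_square)
qed

lemma integral_beta_kernel_quadratic:
  "(LINT x|lborel. beta_kernel \<gamma> x * (x $ i * x $ j)) = (if i = j then beta_V k \<gamma> else 0)"
  for i j k :: "'n::finite"
  using integral_beta_kernel_odd[where i = i and \<phi> = "\<lambda>x. x $ i * x $ j" and \<gamma> = \<gamma>]
  by (cases "i = j") (auto simp: integral_beta_kernel_square)

lemma beta_V_pos:
  assumes "0 \<le> \<gamma>"
  shows "0 < beta_V (k :: 'n::finite) \<gamma>"
  unfolding beta_V_def
proof (rule integral_lborel_pos[where U = "ball 0 1 \<inter> {x. x $ k \<noteq> 0}"])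
  show "integrable lborel (\<lambda>x :: real ^ 'n. (x $ k)\<^sup>2 * beta_kernel \<gamma> x)"
    using integrable_beta_kernel_monomials(3)[OF assms, of k k] by (simp add: power2_eq_square mult.commute)
  show "open (ball 0 1 \<inter> {x :: real ^ 'n. x $ k \<noteq> 0})"
    by (intro open_Int open_ball open_Collect_neq continuous_intros)
  have "(1 / 2) *\<^sub>R axis k 1 \<in> ball 0 1 \<inter> {x :: real ^ 'n. x $ k \<noteq> 0}"
    by simp
  then show "ball 0 1 \<inter> {x :: real ^ 'n. x $ k \<noteq> 0} \<noteq> {}"
    by blast
qed (auto simp: beta_kernel_nonneg[OF assms] beta_kernel_pos[OF assms])

text \<open>Applied to a Taylor polynomial, the kernel sees its constant term and the trace of its quadratic
  part; for a Hessian the trace is the Laplacian.\<close>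

lemma integral_beta_kernel_second_order:
  fixes a :: real and b :: "'n::finite \<Rightarrow> real" and c :: "'n \<Rightarrow> 'n \<Rightarrow> real" and k :: 'n
  assumes \<gamma>: "0 \<le> \<gamma>"
  defines "p \<equiv> \<lambda>x :: real ^ 'n. a + (\<Sum>i\<in>UNIV. b i * x $ i) + (\<Sum>i\<in>UNIV. \<Sum>j\<in>UNIV. c i j * (x $ i * x $ j))"
  shows "integrable lborel (\<lambda>x. beta_kernel \<gamma> x * p x)"
    and "(LINT x|lborel. beta_kernel \<gamma> x * p x) = a + beta_V k \<gamma> * (\<Sum>i\<in>UNIV. c i i)"
proof -
  note int = integrable_beta_kernel_monomials[OF \<gamma>, where 'n = 'n]
  have eq: "beta_kernel \<gamma> x * p x = a * beta_kernel \<gamma> x + (\<Sum>i\<in>UNIV. b i * (beta_kernel \<gamma> x * x $ i))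
      + (\<Sum>i\<in>UNIV. \<Sum>j\<in>UNIV. c i j * (beta_kernel \<gamma> x * (x $ i * x $ j)))" for x
    by (simp add: p_def distrib_left sum_distrib_left mult_ac)
  have ints: "integrable lborel (\<lambda>x. a * beta_kernel \<gamma> (x :: real ^ 'n))"
    "integrable lborel (\<lambda>x :: real ^ 'n. \<Sum>i\<in>UNIV. b i * (beta_kernel \<gamma> x * x $ i))"
    "integrable lborel (\<lambda>x :: real ^ 'n. \<Sum>i\<in>UNIV. \<Sum>j\<in>UNIV. c i j * (beta_kernel \<gamma> x * (x $ i * x $ j)))"
    by (intro Bochner_Integration.integrable_sum integrable_mult_right int)+
  show "integrable lborel (\<lambda>x. beta_kernel \<gamma> x * p x)"
    unfolding eq by (intro Bochner_Integration.integrable_add ints)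
  have "(LINT x|lborel. beta_kernel \<gamma> x * p x)
      = a * 1 + (\<Sum>i\<in>UNIV. b i * 0) + (\<Sum>i\<in>UNIV. \<Sum>j\<in>UNIV. c i j * (if i = j then beta_V k \<gamma> else 0))"
    by (simp only: eq Bochner_Integration.integral_add ints Bochner_Integration.integrable_add
        Bochner_Integration.integral_sum Bochner_Integration.integrable_sum int integral_mult_right_zero
        integrable_mult_right integral_beta_kernel[OF \<gamma>] integral_beta_kernel_linear
        integral_beta_kernel_quadratic[where k = k])
  then show "(LINT x|lborel. beta_kernel \<gamma> x * p x) = a + beta_V k \<gamma> * (\<Sum>i\<in>UNIV. c i i)"
    by (simp add: sum_distrib_left mult.commute if_distrib cong: if_cong)
qed

section \<open>Taylor expansion with Hoelder second derivatives\<close>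

lemma has_real_derivative_along_line:
  fixes f :: "real ^ 'n::finite \<Rightarrow> real"
  assumes "f differentiable at (x + t *\<^sub>R v)"
  shows "((\<lambda>t. f (x + t *\<^sub>R v)) has_real_derivative (\<Sum>i\<in>UNIV. v $ i * partial i f (x + t *\<^sub>R v))) (at t)"
proof -
  define f' where "f' = frechet_derivative f (at (x + t *\<^sub>R v))"
  have f': "(f has_derivative f') (at (x + t *\<^sub>R v))"
    using assms unfolding f'_def by (simp add: frechet_derivative_works)
  then have "linear f'"
    by (rule has_derivative_linear)
  have "((\<lambda>t. f (x + t *\<^sub>R v)) has_derivative (\<lambda>s. f' (s *\<^sub>R v))) (at t)"
    by (rule has_derivative_compose[where g = f and f = "\<lambda>t. x + t *\<^sub>R v", OF _ f'])
      (auto intro!: derivative_eq_intros)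
  moreover have "f' (s *\<^sub>R v) = (\<Sum>i\<in>UNIV. v $ i * partial i f (x + t *\<^sub>R v)) * s" for s
  proof -
    have "f' v = f' (\<Sum>i\<in>UNIV. v $ i *\<^sub>R axis i 1)"
      using basis_expansion[of v] by (simp add: scalar_mult_eq_scaleR)
    also have "\<dots> = (\<Sum>i\<in>UNIV. v $ i * f' (axis i 1))"
      by (simp add: linear_sum[OF \<open>linear f'\<close>] linear_scale[OF \<open>linear f'\<close>])
    finally have "f' v = (\<Sum>i\<in>UNIV. v $ i * partial i f (x + t *\<^sub>R v))"
      by (simp add: f'_def partial_def)
    then show ?thesis
      by (simp add: linear_scale[OF \<open>linear f'\<close>] mult.commute)
  qed
  ultimately show ?thesis
    by (simp add: has_field_derivative_def)
qed

lemma C1_on_differentiable_at: "C1_on W f \<Longrightarrow> open W \<Longrightarrow> x \<in> W \<Longrightarrow> f differentiable at x"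
  by (simp add: C1_on_def differentiable_on_eq_differentiable_at)

text \<open>Along the segment from \<open>x\<close> to \<open>x + v\<close>, Taylor's theorem with Lagrange remainder evaluates the second
  derivative at an intermediate point. Replacing that point by \<open>x\<close> costs \<open>C * norm v powr \<alpha>\<close> in each
  entry of the Hessian, and the quadratic form has \<open>CARD('n)\<^sup>2\<close> entries, each with a factor at
  most \<open>(norm v)\<^sup>2\<close>.\<close>

lemma second_order_taylor_hoelder:
  fixes l :: "real ^ 'n::finite \<Rightarrow> real"
  assumes W: "open W" and C2: "C2_on W l" and sub: "cball x \<delta> \<subseteq> W" and v: "norm v \<le> \<delta>"
    and \<alpha>: "0 < \<alpha>" and C: "0 \<le> C"
    and hoelder: "\<And>y z i j. y \<in> W \<Longrightarrow> z \<in> W \<Longrightarrow>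
      \<bar>partial2 i j l y - partial2 i j l z\<bar> \<le> C * norm (y - z) powr \<alpha>"
  shows "\<bar>l (x + v) - (l x + (\<Sum>i\<in>UNIV. partial i l x * v $ i)
        + (\<Sum>i\<in>UNIV. \<Sum>j\<in>UNIV. partial2 i j l x / 2 * (v $ i * v $ j)))\<bar>
    \<le> (real CARD('n))\<^sup>2 * C / 2 * norm v powr (2 + \<alpha>)"
proof -
  define P where "P = (\<lambda>t. x + t *\<^sub>R v)"
  define diff where "diff m t =
    (if m = 0 then l (P t)
     else if m = 1 then \<Sum>j\<in>UNIV. v $ j * partial j l (P t)
     else \<Sum>j\<in>UNIV. v $ j * (\<Sum>i\<in>UNIV. v $ i * partial2 i j l (P t)))" for m :: nat and t
  have P_W: "P t \<in> W" and P_le: "norm (P t - x) \<le> norm v" if "0 \<le> t" "t \<le> 1" for t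
  proof -
    have "norm (t *\<^sub>R v) \<le> 1 * norm v"
      using that unfolding norm_scaleR by (intro mult_right_mono) auto
    then show "norm (P t - x) \<le> norm v" by (simp add: P_def)
    then show "P t \<in> W" using v sub by (auto simp: dist_norm norm_minus_commute subset_iff)
  qed
  have C1: "C1_on W l" "\<And>j. C1_on W (partial j l)"
    using C2 by (auto simp: C2_on_def)
  have deriv: "DERIV (diff m) t :> diff (Suc m) t" if "m < 2" "0 \<le> t" "t \<le> 1" for m t
  proof -
    note d = C1_on_differentiable_at[OF _ W P_W[OF that(2,3)]]
    have "m = 0 \<or> m = 1" using that by auto
    then show ?thesis
    proof
      assume "m = 0"
      then show ?thesis
        using has_real_derivative_along_line[OF d[OF C1(1), unfolded P_def]] by (simp add: \<open>m = 0\<close> diff_def[abs_def] P_def)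
    next
      assume "m = 1"
      then show ?thesis
        using has_real_derivative_along_line[OF d[OF C1(2), unfolded P_def]]
        by (simp add: \<open>m = 1\<close> diff_def[abs_def] P_def) (intro DERIV_sum DERIV_cmult)
    qed
  qed
  obtain t where t: "0 < t" "t < 1" and
    taylor: "l (P 1) = (\<Sum>m<2. diff m 0 / fact m * 1 ^ m) + diff 2 t / fact 2 * 1 ^ 2"
    using Maclaurin[of 1 2 diff "\<lambda>t. l (P t)"] deriv by (auto simp: diff_def fun_eq_iff)
  have "l (x + v) = l x + (\<Sum>i\<in>UNIV. partial i l x * v $ i) + diff 2 t / 2"
    using taylor by (simp add: diff_def P_def numeral_2_eq_2 mult.commute)
  moreover have "(\<Sum>i\<in>UNIV. \<Sum>j\<in>UNIV. partial2 i j l x / 2 * (v $ i * v $ j)) = diff 2 0 / 2"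
    by (subst sum.swap) (simp add: diff_def P_def sum_distrib_left sum_divide_distrib mult_ac)
  ultimately have eq: "l (x + v) - (l x + (\<Sum>i\<in>UNIV. partial i l x * v $ i)
        + (\<Sum>i\<in>UNIV. \<Sum>j\<in>UNIV. partial2 i j l x / 2 * (v $ i * v $ j))) = (diff 2 t - diff 2 0) / 2"
    by (simp add: diff_divide_distrib)
  have "\<bar>diff 2 t - diff 2 0\<bar>
      = \<bar>\<Sum>j\<in>UNIV. \<Sum>i\<in>UNIV. v $ j * v $ i * (partial2 i j l (P t) - partial2 i j l x)\<bar>"
    by (simp add: diff_def P_def sum_distrib_left sum_subtractf right_diff_distrib mult.assoc)
  also have "\<dots> \<le> (\<Sum>j\<in>UNIV. \<Sum>i\<in>UNIV. \<bar>v $ j * v $ i * (partial2 i j l (P t) - partial2 i j l x)\<bar>)"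
    by (rule order.trans[OF sum_abs sum_mono[OF sum_abs]])
  also have "\<dots> \<le> (\<Sum>j\<in>(UNIV :: 'n set). \<Sum>i\<in>(UNIV :: 'n set). norm v * norm v * (C * norm v powr \<alpha>))"
  proof (intro sum_mono)
    fix i j
    have "\<bar>partial2 i j l (P t) - partial2 i j l x\<bar> \<le> C * norm (P t - x) powr \<alpha>"
      using hoelder[OF P_W P_W[of 0]] t by (simp add: P_def)
    also have "\<dots> \<le> C * norm v powr \<alpha>"
      using t P_le[of t] \<alpha> C by (intro mult_left_mono powr_mono2) auto
    finally show "\<bar>v $ j * v $ i * (partial2 i j l (P t) - partial2 i j l x)\<bar>
        \<le> norm v * norm v * (C * norm v powr \<alpha>)"
      unfolding abs_mult by (intro mult_mono) (auto simp: component_le_norm_cart)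
  qed
  also have "\<dots> = (real CARD('n))\<^sup>2 * C * (norm v * norm v * norm v powr \<alpha>)"
    by (simp add: power2_eq_square mult_ac)
  also have "norm v * norm v * norm v powr \<alpha> = norm v powr (2 + \<alpha>)"
    by (cases "v = 0") (simp_all add: powr_add power2_eq_square)
  finally show ?thesis unfolding eq by simp
qed

section \<open>The optimal bandwidth\<close>

lemma exp_gt_one_plus:
  fixes x :: real
  assumes "x \<noteq> 0"
  shows "1 + x < exp x"
proof (cases "1 + x > 0")
  case True
  then have "exp x \<noteq> 1 + x"
    using assms ln_eq_minus_one[of "1 + x"] by (metis add_diff_cancel_left' add_cancel_left_right ln_exp)
  then show ?thesis using exp_ge_add_one_self[of x] by linarith
next
  case False
  then show ?thesis using exp_gt_zero[of x] by linarith
qed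

text \<open>With \<open>t = exp s\<close> the tangent lines of \<open>exp\<close> at 0 give \<open>d * (1 + 4 * s) + 4 * (1 - d * s)\<close> as a lower
  bound, in which \<open>s\<close> cancels.\<close>

lemma power_balance_strict_min:
  fixes d :: nat and t :: real
  assumes d: "0 < d" and t: "0 < t" "t \<noteq> 1"
  shows "real d + 4 < real d * t ^ 4 + 4 / t ^ d"
proof -
  define s where "s = ln t"
  have s: "s \<noteq> 0" "t = exp s" using t by (auto simp: s_def)
  have "1 + 4 * s < exp (4 * s)" "1 - real d * s < exp (- (real d * s))"
    using exp_gt_one_plus[of "4 * s"] exp_gt_one_plus[of "- (real d * s)"] s d by auto
  then have "real d * (1 + 4 * s) + 4 * (1 - real d * s) < real d * exp (4 * s) + 4 * exp (- (real d * s))"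
    using d by (intro add_strict_mono mult_strict_left_mono) auto
  then show ?thesis
    by (simp add: s(2) exp_of_nat_mult[symmetric] exp_minus field_simps flip: exp_of_nat_mult)
qed

text \<open>The equation for \<open>m\<close> is the vanishing of the derivative. It turns both terms into multiples of
  \<open>a * m ^ 4 / d\<close>, so that \<open>b / m\<close> is the remaining variable.\<close>

lemma is_arg_min_bandwidth:
  fixes d :: nat and a c m :: real
  assumes d: "0 < d" and a: "0 < a" and m: "0 < m" and eq: "4 * a * m ^ (d + 4) = real d * c"
  shows "is_arg_min (\<lambda>b. a * b ^ 4 + c / b ^ d) (\<lambda>b. 0 < b) b \<longleftrightarrow> b = m"
proof -
  let ?F = "\<lambda>b. a * b ^ 4 + c / b ^ d"
  have c: "c / m ^ d = 4 * (a * m ^ 4) / d"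
    using eq d m by (simp add: field_simps power_add)
  have less: "?F m < ?F b" if b: "0 < b" "b \<noteq> m" for b
  proof -
    define t where "t = b / m"
    have t: "0 < t" "t \<noteq> 1" "b = m * t" using b m by (auto simp: t_def)
    have pos: "0 < a * m ^ 4 / d" using a m d by simp
    have "?F m = a * m ^ 4 / d * (real d + 4)"
      unfolding c using d by (simp add: field_simps)
    also have "\<dots> < a * m ^ 4 / d * (real d * t ^ 4 + 4 / t ^ d)"
      using power_balance_strict_min[OF d t(1,2)] pos by (rule mult_strict_left_mono)
    also have "\<dots> = a * (m * t) ^ 4 + (4 * (a * m ^ 4) / d) / t ^ d"
      using d by (simp add: field_simps power_mult_distrib)
    also have "\<dots> = ?F b"
      by (simp add: t(3) power_mult_distrib c[symmetric])
    finally show ?thesis .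
  qed
  show ?thesis
  proof
    assume "is_arg_min ?F (\<lambda>b. 0 < b) b"
    then have "0 < b" "\<not> ?F m < ?F b" using m by (auto simp: is_arg_min_def)
    then show "b = m" using less[of b] by blast
  next
    assume "b = m"
    then show "is_arg_min ?F (\<lambda>b. 0 < b) b"
      using m less by (force simp: is_arg_min_def)
  qed
qed

section \<open>Bias and variance of the kernel estimator\<close>

text \<open>The common estimate for bias and variance: the kernel, or its square, is the weight \<open>F\<close>, the
  rescaled intensity is \<open>\<phi>\<close>, and \<open>p\<close> is the approximation of \<open>\<phi>\<close> on the support of the weight.\<close>

lemma weighted_integral_close:
  fixes F \<phi> p :: "'a \<Rightarrow> real"
  assumes F: "integrable M F" "\<And>z. 0 \<le> F z" and Fp: "integrable M (\<lambda>z. F z * p z)"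
    and [measurable]: "\<phi> \<in> borel_measurable M" "p \<in> borel_measurable M"
    and close: "\<And>z. F z \<noteq> 0 \<Longrightarrow> \<bar>\<phi> z - p z\<bar> \<le> \<epsilon>"
  shows "\<bar>(LINT z|M. F z * \<phi> z) - (LINT z|M. F z * p z)\<bar> \<le> \<epsilon> * (LINT z|M. F z)"
proof -
  have [measurable]: "F \<in> borel_measurable M" using F by auto
  have le: "\<bar>F z * (\<phi> z - p z)\<bar> \<le> \<epsilon> * F z" for z
    using close[of z] F(2)[of z]
    by (cases "F z = 0") (auto simp: abs_mult mult.commute intro: mult_right_mono)
  have bound: "integrable M (\<lambda>z. \<epsilon> * F z)"
    using F(1) by (rule integrable_mult_right)
  have int: "integrable M (\<lambda>z. F z * (\<phi> z - p z))"
    by (rule Bochner_Integration.integrable_bound[OF bound])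
      (use le in \<open>auto intro!: AE_I2 intro: order.trans[OF _ abs_ge_self]\<close>)
  have "(LINT z|M. F z * \<phi> z) = (LINT z|M. F z * (\<phi> z - p z) + F z * p z)"
    by (simp add: algebra_simps)
  also have "\<dots> = (LINT z|M. F z * (\<phi> z - p z)) + (LINT z|M. F z * p z)"
    using int Fp by (rule Bochner_Integration.integral_add)
  finally have "\<bar>(LINT z|M. F z * \<phi> z) - (LINT z|M. F z * p z)\<bar> = \<bar>LINT z|M. F z * (\<phi> z - p z)\<bar>"
    by simp
  also have "\<dots> \<le> (LINT z|M. \<bar>F z * (\<phi> z - p z)\<bar>)"
    by (rule integral_abs_bound)
  also have "\<dots> \<le> (LINT z|M. \<epsilon> * F z)"
    using int bound le by (intro integral_mono) auto
  finally show ?thesis by simp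
qed

text \<open>Differentiability at one point bounds the increments from that point linearly; this gives the
  error of freezing the intensity at \<open>x\<^sub>0\<close> in the variance.\<close>

lemma differentiable_imp_pointwise_lipschitz:
  fixes f :: "'a::real_normed_vector \<Rightarrow> real"
  assumes "f differentiable at x"
  obtains L \<delta> where "0 \<le> L" "0 < \<delta>" "\<And>v. norm v < \<delta> \<Longrightarrow> \<bar>f (x + v) - f x\<bar> \<le> L * norm v"
proof -
  obtain f' where f': "(f has_derivative f') (at x)"
    using assms by (auto simp: differentiable_def)
  obtain K where K: "0 \<le> K" "\<And>v. norm (f' v) \<le> norm v * K"
    using bounded_linear.nonneg_bounded[OF has_derivative_bounded_linear[OF f']] by blast
  obtain \<delta> where \<delta>: "0 < \<delta>" "\<And>y. norm (y - x) < \<delta> \<Longrightarrow> norm (f y - f x - f' (y - x)) \<le> 1 * norm (y - x)"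
    using f' unfolding has_derivative_at_alt by (meson zero_less_one)
  show ?thesis
  proof
    show "0 \<le> K + 1" "0 < \<delta>" using K \<delta> by auto
    show "\<bar>f (x + v) - f x\<bar> \<le> (K + 1) * norm v" if "norm v < \<delta>" for v
      using \<delta>(2)[of "x + v"] K(2)[of v] that by (simp add: algebra_simps)
  qed
qed

text \<open>The bias, with \<open>p\<close> in the proof the Taylor polynomial of the intensity in the rescaled variable
  \<open>z = (x - u) / b\<close>.\<close>

lemma kernel_mean_expansion:
  fixes l :: "real ^ 'n::finite \<Rightarrow> real" and k :: 'n
  assumes \<gamma>: "0 \<le> \<gamma>" and W: "open W" and C2: "C2_on W l" and sub: "cball x \<delta> \<subseteq> W"
    and [measurable]: "(\<lambda>u. indicator W u * l u) \<in> borel_measurable borel"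
    and \<alpha>: "0 < \<alpha>" and C: "0 \<le> C"
    and hoelder: "\<And>y z i j. y \<in> W \<Longrightarrow> z \<in> W \<Longrightarrow>
      \<bar>partial2 i j l y - partial2 i j l z\<bar> \<le> C * norm (y - z) powr \<alpha>"
    and b: "0 < b" "b \<le> \<delta>"
  shows "\<bar>(LINT u|lborel. beta_kernel \<gamma> ((1 / b) *\<^sub>R (x - u)) * (indicator W u * l u)) / b ^ CARD('n)
      - (l x + b\<^sup>2 * (beta_V k \<gamma> / 2 * (\<Sum>i\<in>UNIV. partial2 i i l x)))\<bar>
    \<le> (real CARD('n))\<^sup>2 * C / 2 * b powr (2 + \<alpha>)"
proof -
  define D where "D = (real CARD('n))\<^sup>2 * C / 2"
  define \<phi> where "\<phi> z = indicator W (x - b *\<^sub>R z) * l (x - b *\<^sub>R z)" for z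
  define p where "p z = l x + (\<Sum>i\<in>UNIV. - b * partial i l x * z $ i)
    + (\<Sum>i\<in>UNIV. \<Sum>j\<in>UNIV. b\<^sup>2 * partial2 i j l x / 2 * (z $ i * z $ j))" for z :: "real ^ 'n"
  have scale: "(LINT u|lborel. beta_kernel \<gamma> ((1 / b) *\<^sub>R (x - u)) * (indicator W u * l u)) / b ^ CARD('n)
      = (LINT z|lborel. beta_kernel \<gamma> z * \<phi> z)"
    using b lborel_integral_rescale[of "beta_kernel \<gamma>" "\<lambda>u. indicator W u * l u" b x]
    by (simp add: \<phi>_def)
  have "\<bar>(LINT z|lborel. beta_kernel \<gamma> z * \<phi> z) - (LINT z|lborel. beta_kernel \<gamma> z * p z)\<bar>
      \<le> D * b powr (2 + \<alpha>) * (LINT z|lborel. beta_kernel \<gamma> (z :: real ^ 'n))"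
  proof (rule weighted_integral_close)
    fix z :: "real ^ 'n" assume "beta_kernel \<gamma> z \<noteq> 0"
    then have z: "norm z \<le> 1" using beta_kernel_outside[of z \<gamma>] by auto
    define v where "v = - (b *\<^sub>R z)"
    have nv: "norm v \<le> b"
      using mult_left_mono[OF z, of b] b by (simp add: v_def)
    have v: "norm v \<le> \<delta>" using nv b by simp
    then have "x + v \<in> W" using sub by (auto simp: subset_iff dist_norm)
    then have "\<phi> z = l (x + v)" by (simp add: \<phi>_def v_def)
    moreover have "p z = l x + (\<Sum>i\<in>UNIV. partial i l x * v $ i)
        + (\<Sum>i\<in>UNIV. \<Sum>j\<in>UNIV. partial2 i j l x / 2 * (v $ i * v $ j))"
      by (simp add: p_def v_def power2_eq_square mult_ac)
    ultimately have "\<bar>\<phi> z - p z\<bar> \<le> D * norm v powr (2 + \<alpha>)"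
      using second_order_taylor_hoelder[OF W C2 sub v \<alpha> C hoelder] by (simp add: D_def)
    also have "\<dots> \<le> D * b powr (2 + \<alpha>)"
      using nv C \<alpha> by (intro mult_left_mono powr_mono2) (auto simp: D_def)
    finally show "\<bar>\<phi> z - p z\<bar> \<le> D * b powr (2 + \<alpha>)" .
  next
    show "integrable lborel (\<lambda>z. beta_kernel \<gamma> z * p z)"
      unfolding p_def using \<gamma> by (rule integral_beta_kernel_second_order)
    have "(\<lambda>z. x - b *\<^sub>R z) \<in> borel_measurable lborel" by measurable
    then show "\<phi> \<in> borel_measurable lborel"
      unfolding \<phi>_def by (rule measurable_compose) measurable
    show "p \<in> borel_measurable lborel"
      unfolding p_def by measurable
  qed (use \<gamma> in \<open>auto simp: beta_kernel_nonneg integrable_beta_kernel_monomials(1)\<close>)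
  also have "(LINT z|lborel. beta_kernel \<gamma> (z :: real ^ 'n)) = 1"
    using \<gamma> by (rule integral_beta_kernel)
  also have "(LINT z|lborel. beta_kernel \<gamma> z * p z)
      = l x + beta_V k \<gamma> * (\<Sum>i\<in>UNIV. b\<^sup>2 * partial2 i i l x / 2)"
    unfolding p_def using \<gamma> by (rule integral_beta_kernel_second_order)
  also have "(\<Sum>i\<in>UNIV. b\<^sup>2 * partial2 i i l x / 2) = b\<^sup>2 / 2 * (\<Sum>i\<in>UNIV. partial2 i i l x)"
    by (simp add: sum_distrib_left)
  finally show ?thesis
    unfolding scale by (simp add: D_def mult_ac)
qed

text \<open>The zeroth order version for a general weight \<open>F\<close>. With the squared kernel it gives the leading
  term of the variance, with the kernel itself it shows that the rescaled mean stays bounded.\<close>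

lemma kernel_weight_first_order:
  fixes l :: "real ^ 'n::finite \<Rightarrow> real"
  assumes F: "integrable lborel F" "\<And>z. 0 \<le> F z" "\<And>z. z \<notin> cball 0 1 \<Longrightarrow> F z = 0"
    and [measurable]: "(\<lambda>u. indicator W u * l u) \<in> borel_measurable borel"
    and L: "0 \<le> L" "\<And>v. norm v \<le> b \<Longrightarrow> x + v \<in> W \<and> \<bar>l (x + v) - l x\<bar> \<le> L * norm v"
    and b: "0 < b"
  shows "\<bar>(LINT u|lborel. F ((1 / b) *\<^sub>R (x - u)) * (indicator W u * l u)) / b ^ CARD('n)
      - l x * (LINT z|lborel. F z)\<bar> \<le> L * b * (LINT z|lborel. F z)"
proof -
  define \<phi> where "\<phi> z = indicator W (x - b *\<^sub>R z) * l (x - b *\<^sub>R z)" for z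
  have [measurable]: "F \<in> borel_measurable borel" using F(1) by auto
  have scale: "(LINT u|lborel. F ((1 / b) *\<^sub>R (x - u)) * (indicator W u * l u)) / b ^ CARD('n)
      = (LINT z|lborel. F z * \<phi> z)"
    using b lborel_integral_rescale[of F "\<lambda>u. indicator W u * l u" b x]
    by (simp add: \<phi>_def)
  have "\<bar>(LINT z|lborel. F z * \<phi> z) - (LINT z|lborel. F z * l x)\<bar> \<le> L * b * (LINT z|lborel. F z)"
  proof (rule weighted_integral_close)
    fix z :: "real ^ 'n" assume "F z \<noteq> 0"
    then have z: "norm z \<le> 1" using F(3)[of z] by auto
    have nv: "norm (- (b *\<^sub>R z)) \<le> b"
      using mult_left_mono[OF z, of b] b by simp
    have "\<bar>\<phi> z - l x\<bar> \<le> L * norm (- (b *\<^sub>R z))"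
      using L(2)[OF nv] by (simp add: \<phi>_def)
    also have "\<dots> \<le> L * b"
      using nv L(1) by (rule mult_left_mono)
    finally show "\<bar>\<phi> z - l x\<bar> \<le> L * b" .
  next
    have "(\<lambda>z. x - b *\<^sub>R z) \<in> borel_measurable lborel" by measurable
    then show "\<phi> \<in> borel_measurable lborel"
      unfolding \<phi>_def by (rule measurable_compose) measurable
    show "integrable lborel (\<lambda>z. F z * l x)"
      using F(1) by (rule integrable_mult_left)
  qed (use F in auto)
  then show ?thesis unfolding scale by (simp add: mult.commute)
qed

text \<open>The variance \<open>v\<close> of a single sum is kept as an unknown number close to its diagonal part \<open>A\<close>,
  and independence divides it by \<open>n\<close>.\<close>

lemma (in prob_space) mse_kernel_estimator:
  fixes \<Phi> :: "nat \<Rightarrow> 'a \<Rightarrow> (real ^ 'n::finite) set" and x :: "real ^ 'n"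
  assumes iid: "iid_point_processes M \<Phi>" and W: "W \<in> sets borel" "bounded W"
    and l: "has_intensity_function M (\<Phi> 1) W l" and \<rho>: "has_product_density2 M (\<Phi> 1) W \<rho>"
    and G: "0 \<le> G" "\<And>u v. u \<in> W \<Longrightarrow> v \<in> W \<Longrightarrow> \<rho> (u, v) \<le> G * (l u * l v)"
    and \<gamma>: "0 \<le> \<gamma>" and n: "1 \<le> n" and b: "0 < b"
  defines "m \<equiv> LINT u|lborel. beta_kernel \<gamma> ((1 / b) *\<^sub>R (x - u)) * (indicator W u * l u)"
    and "A \<equiv> LINT u|lborel. (beta_kernel \<gamma> ((1 / b) *\<^sub>R (x - u)))\<^sup>2 * (indicator W u * l u)"
  shows "integrable M (\<lambda>\<omega>. (kernel_estimator \<gamma> W \<Phi> n b x \<omega> - \<theta>)\<^sup>2)"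
    and "\<exists>v. \<bar>v - A\<bar> \<le> (G + 1) * m\<^sup>2 \<and>
      mse M (kernel_estimator \<gamma> W \<Phi> n b x) \<theta>
        = v / (real n * (b ^ CARD('n))\<^sup>2) + (m / b ^ CARD('n) - \<theta>)\<^sup>2"
proof -
  define f where "f y = beta_kernel \<gamma> ((1 / b) *\<^sub>R (x - y))" for y
  define s where "s S = (\<Sum>y\<in>S \<inter> W. f y)" for S
  have pp: "\<Phi> i \<in> measurable M config_space" if "1 \<le> i" for i
    using iid that unfolding iid_point_processes_def point_process_def by blast
  have [measurable]: "f \<in> borel_measurable borel"
    unfolding f_def by measurable
  have f_nn: "0 \<le> f y" for y
    unfolding f_def using \<gamma> by (rule beta_kernel_nonneg)
  have f_le: "f y \<le> inverse (beta_c TYPE('n) \<gamma>)" for y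
    unfolding f_def using beta_c_pos[OF \<gamma>, where 'n = 'n]
    by (intro order.trans[OF beta_kernel_le[OF \<gamma>]]) (auto simp: indicator_def)
  have s[measurable]: "s \<in> borel_measurable config_space"
    unfolding s_def using W by (intro measurable_config_sum f_nn) auto
  have distr: "distr M config_space (\<Phi> i) = distr M config_space (\<Phi> 1)" if "1 \<le> i" for i
    using iid that unfolding iid_point_processes_def by blast
  \<comment> \<open>Moments of the sum depend on the law of the process alone, and all processes have the
    law of the first.\<close>
  have same_integrable: "integrable M (\<lambda>\<omega>. g (\<Phi> i \<omega>)) \<longleftrightarrow> integrable M (\<lambda>\<omega>. g (\<Phi> 1 \<omega>))"
    and same_expectation: "expectation (\<lambda>\<omega>. g (\<Phi> i \<omega>)) = expectation (\<lambda>\<omega>. g (\<Phi> 1 \<omega>))"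
    if "1 \<le> i" "g \<in> borel_measurable config_space" for i and g :: "(real ^ 'n) set \<Rightarrow> real"
    using distr[OF that(1)] integrable_distr_eq[OF pp that(2)] integral_distr[OF pp that(2)] that(1)
    by (metis order_refl)+
  have pp1: "point_process M (\<Phi> 1)"
    using pp[of 1] by (simp add: point_process_def)
  note mom = config_sum_moments[OF pp1 W l \<rho> G(2,1) \<open>f \<in> _\<close> f_nn f_le, folded s_def]
  have m: "expectation (\<lambda>\<omega>. s (\<Phi> 1 \<omega>)) = m"
    using mom(3) by (simp add: m_def f_def)
  define v where "v = variance (\<lambda>\<omega>. s (\<Phi> 1 \<omega>))"
  have Y: "integrable M (\<lambda>\<omega>. s (\<Phi> i \<omega>))" "integrable M (\<lambda>\<omega>. (s (\<Phi> i \<omega>))\<^sup>2)"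
    "expectation (\<lambda>\<omega>. s (\<Phi> i \<omega>)) = m" "variance (\<lambda>\<omega>. s (\<Phi> i \<omega>)) = v" if i: "i \<in> {1..n}" for i
  proof -
    have i: "1 \<le> i" using i by simp
    show "integrable M (\<lambda>\<omega>. s (\<Phi> i \<omega>))" "integrable M (\<lambda>\<omega>. (s (\<Phi> i \<omega>))\<^sup>2)"
      using same_integrable[OF i, of s] same_integrable[OF i, of "\<lambda>S. (s S)\<^sup>2"] mom(1,2) by simp_all
    show mi: "expectation (\<lambda>\<omega>. s (\<Phi> i \<omega>)) = m"
      using same_expectation[OF i, of s] m by simp
    show "variance (\<lambda>\<omega>. s (\<Phi> i \<omega>)) = v"
      unfolding mi v_def m using same_expectation[OF i, of "\<lambda>S. (s S - m)\<^sup>2"] by simp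
  qed
  have "indep_vars (\<lambda>_. config_space) \<Phi> {1..n}"
    using iid unfolding iid_point_processes_def
    by (intro indep_vars_subset[of _ \<Phi> "{1..}" "{1..n}"]) auto
  then have indep: "indep_vars (\<lambda>_. borel) (\<lambda>i \<omega>. s (\<Phi> i \<omega>)) {1..n}"
    by (rule indep_vars_compose2) (rule s)
  have est: "kernel_estimator \<gamma> W \<Phi> n b x = (\<lambda>\<omega>. 1 / (real n * b ^ CARD('n)) * (\<Sum>i=1..n. s (\<Phi> i \<omega>)))"
    by (simp add: kernel_estimator_def s_def f_def fun_eq_iff)
  have c: "0 < b ^ CARD('n)" using b by simp
  show "integrable M (\<lambda>\<omega>. (kernel_estimator \<gamma> W \<Phi> n b x \<omega> - \<theta>)\<^sup>2)"
    unfolding est by (rule mse_scaled_mean(1)[OF indep n c Y])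
  have "mse M (kernel_estimator \<gamma> W \<Phi> n b x) \<theta>
      = v / (real n * (b ^ CARD('n))\<^sup>2) + (m / b ^ CARD('n) - \<theta>)\<^sup>2"
    unfolding est by (rule mse_scaled_mean(2)[OF indep n c Y])
  moreover have "\<bar>v - A\<bar> \<le> (G + 1) * m\<^sup>2"
    using mom(4) by (simp add: v_def A_def m_def f_def)
  ultimately show "\<exists>v. \<bar>v - A\<bar> \<le> (G + 1) * m\<^sup>2 \<and>
      mse M (kernel_estimator \<gamma> W \<Phi> n b x) \<theta>
        = v / (real n * (b ^ CARD('n))\<^sup>2) + (m / b ^ CARD('n) - \<theta>)\<^sup>2"
    by blast
qed

text \<open>With \<open>e\<close> the deviation of the bias \<open>\<beta>\<close> from its leading term, the difference of squares is
  \<open>e * (2 * b\<^sup>2 * c + e)\<close>, and \<open>b \<le> 1\<close> gives \<open>b powr (2 + \<alpha>) \<le> b\<^sup>2\<close> for the second factor.\<close>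

lemma squared_bias_remainder:
  fixes b \<beta> e c D \<alpha> :: real
  assumes b: "0 < b" "b \<le> 1" and \<alpha>: "0 < \<alpha>" and D: "0 \<le> D"
    and e: "\<bar>\<beta> - b\<^sup>2 * c\<bar> \<le> D * b powr (2 + \<alpha>)"
  shows "\<bar>\<beta>\<^sup>2 - b ^ 4 * c\<^sup>2\<bar> \<le> D * (2 * \<bar>c\<bar> + D) * b powr (4 + \<alpha>)"
proof -
  define e where "e = \<beta> - b\<^sup>2 * c"
  have b2: "b\<^sup>2 = b powr 2" using b by simp
  have split: "b powr (2 + \<alpha>) * b\<^sup>2 = b powr (4 + \<alpha>)"
    unfolding b2 using powr_add[of b "2 + \<alpha>" 2] by (simp add: ac_simps)
  have "b powr (2 + \<alpha>) \<le> b\<^sup>2"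
    unfolding b2 using b \<alpha> by (intro powr_mono') auto
  then have "D * b powr (2 + \<alpha>) \<le> D * b\<^sup>2"
    using D by (rule mult_left_mono)
  then have "\<bar>2 * (b\<^sup>2 * c) + e\<bar> \<le> b\<^sup>2 * (2 * \<bar>c\<bar> + D)"
    using e abs_triangle_ineq[of "2 * (b\<^sup>2 * c)" e] by (simp add: e_def abs_mult algebra_simps)
  then have "\<bar>e\<bar> * \<bar>2 * (b\<^sup>2 * c) + e\<bar> \<le> (D * b powr (2 + \<alpha>)) * (b\<^sup>2 * (2 * \<bar>c\<bar> + D))"
    using e D by (intro mult_mono) (auto simp: e_def)
  moreover have "\<beta>\<^sup>2 - b ^ 4 * c\<^sup>2 = e * (2 * (b\<^sup>2 * c) + e)"
    by (simp add: e_def power2_eq_square power4_eq_xxxx algebra_simps)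
  moreover have "(D * b powr (2 + \<alpha>)) * (b\<^sup>2 * (2 * \<bar>c\<bar> + D)) = D * (2 * \<bar>c\<bar> + D) * b powr (4 + \<alpha>)"
    unfolding split[symmetric] by (simp add: ac_simps)
  ultimately show ?thesis
    by (simp add: abs_mult)
qed

text \<open>Two errors of relative size at most \<open>b\<close>: freezing the intensity contributes \<open>K * b\<close>, and the pair
  term contributes \<open>G * B\<^sup>2\<close> after division by \<open>(b ^ d)\<^sup>2\<close>, which is at most
  \<open>G * B\<^sup>2 / b ^ (d - 1)\<close> because \<open>b \<le> 1\<close>.\<close>

lemma variance_remainder:
  fixes b v A m G B q :: real
  assumes b: "0 < b" "b \<le> 1" and d: "0 < d" and n: "1 \<le> n" and G: "0 \<le> G"
    and v: "\<bar>v - A\<bar> \<le> G * m\<^sup>2" and m: "\<bar>m / b ^ d\<bar> \<le> B" and A: "\<bar>A / b ^ d - q\<bar> \<le> K * b" and K: "0 \<le> K"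
  shows "\<bar>v / (real n * (b ^ d)\<^sup>2) - q / (real n * b ^ d)\<bar> \<le> (G * B\<^sup>2 + K) * (1 / (real n * b ^ (d - 1)))"
proof -
  define c where "c = b ^ d"
  define c' where "c' = b ^ (d - 1)"
  have c: "0 < c" "c = b * c'" and c': "0 < c'" "c' \<le> 1"
    using b d by (auto simp: c_def c'_def power_le_one simp flip: power_Suc)
  have "\<bar>(v - A) / c\<^sup>2\<bar> \<le> G * (m / c)\<^sup>2"
    using v c by (simp add: abs_divide power_divide divide_right_mono)
  also have "\<dots> \<le> G * B\<^sup>2"
  proof -
    have "(m / c)\<^sup>2 \<le> B\<^sup>2"
      using m unfolding c_def by (metis abs_ge_zero power2_abs power_mono)
    then show ?thesis using G by (intro mult_left_mono) auto
  qed
  also have "\<dots> \<le> G * B\<^sup>2 / c'"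
    using G c' by (simp add: le_divide_eq mult_left_le)
  finally have 1: "\<bar>(v - A) / c\<^sup>2\<bar> \<le> G * B\<^sup>2 / c'" .
  have "\<bar>(A / c - q) / c\<bar> \<le> K * b / c"
    using A c(1) by (simp add: abs_divide divide_right_mono flip: c_def)
  also have "\<dots> = K / c'"
    using b c' unfolding c(2) by simp
  finally have 2: "\<bar>(A / c - q) / c\<bar> \<le> K / c'" .
  have "v / (real n * c\<^sup>2) - q / (real n * c) = ((v - A) / c\<^sup>2 + (A / c - q) / c) / real n"
    by (simp add: diff_divide_distrib add_divide_distrib power2_eq_square mult.commute)
  then have "\<bar>v / (real n * c\<^sup>2) - q / (real n * c)\<bar> = \<bar>(v - A) / c\<^sup>2 + (A / c - q) / c\<bar> / real n"
    by (simp add: abs_divide)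
  also have "\<dots> \<le> (G * B\<^sup>2 / c' + K / c') / real n"
    using 1 2 by (intro divide_right_mono order.trans[OF abs_triangle_ineq] add_mono) auto
  finally show ?thesis
    by (simp add: c_def c'_def add_divide_distrib ring_distribs mult.commute)
qed

section \<open>The expansion of the mean squared error\<close>

theorem corollary1:
  fixes M :: "'m measure"
    and W :: "(real ^ 'n::finite) set"
    and \<Phi> :: "nat \<Rightarrow> 'm \<Rightarrow> (real ^ 'n) set"
    and l :: "real ^ 'n \<Rightarrow> real"
    and \<rho> :: "(real ^ 'n) \<times> (real ^ 'n) \<Rightarrow> real"
    and \<alpha> \<gamma> :: real
    and h :: "nat \<Rightarrow> real"
    and x\<^sub>0 :: "real ^ 'n"
    and k :: 'n
  assumes "prob_space M"
    and "W \<noteq> {}" and "bounded W" and "open W"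
    and "iid_point_processes M \<Phi>"
    and "has_intensity_function M (\<Phi> 1) W l"
    and "has_product_density2 M (\<Phi> 1) W \<rho>"
    and "bounded (pair_correlation l \<rho> ` (W \<times> W))"
    and "\<forall>x\<in>W. 0 < l x"
    and "C2_on W l"
    and "\<alpha> > 0"
    and "\<exists>C>0. \<forall>x\<in>W. \<forall>y\<in>W. \<forall>i j.
           \<bar>partial2 i j l x - partial2 i j l y\<bar> \<le> C * norm (x - y) powr \<alpha>"
    and "\<gamma> \<ge> 0"
    and "\<forall>n\<ge>1. 0 < h n"
    and "h \<longlonglongrightarrow> 0"
    and "filterlim (\<lambda>n. real n * h n ^ CARD('n)) at_top sequentially"
    and "x\<^sub>0 \<in> W"
  shows "(\<forall>n\<ge>1. integrable M (\<lambda>\<omega>. (kernel_estimator \<gamma> W \<Phi> n (h n) x\<^sub>0 \<omega> - l x\<^sub>0)\<^sup>2)) \<and>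
    (\<exists>R\<^sub>1 R\<^sub>2 :: nat \<Rightarrow> real.
       R\<^sub>1 \<in> O(\<lambda>n. h n powr (4 + \<alpha>)) \<and>
       R\<^sub>2 \<in> O(\<lambda>n. 1 / (real n * h n ^ (CARD('n) - 1))) \<and>
       (\<forall>n\<ge>1. mse M (kernel_estimator \<gamma> W \<Phi> n (h n) x\<^sub>0) (l x\<^sub>0) =
          h n ^ 4 * ((beta_V k \<gamma>)\<^sup>2 / 4) * (\<Sum>i\<in>UNIV. partial2 i i l x\<^sub>0)\<^sup>2 +
          l x\<^sub>0 * beta_Q TYPE('n) \<gamma> / (real n * h n ^ CARD('n)) + R\<^sub>1 n + R\<^sub>2 n)) \<and>
    ((\<Sum>i\<in>UNIV. partial2 i i l x\<^sub>0) \<noteq> 0 \<longrightarrow>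
       (\<forall>n\<ge>1. \<forall>b. is_arg_min (asymptotic_mse k \<gamma> l x\<^sub>0 n) (\<lambda>b. b > 0) b \<longleftrightarrow>
          b = 1 / real n powr (1 / (real CARD('n) + 4)) *
              (real CARD('n) * l x\<^sub>0 * beta_Q TYPE('n) \<gamma> /
               ((beta_V k \<gamma>)\<^sup>2 * (\<Sum>i\<in>UNIV. partial2 i i l x\<^sub>0)\<^sup>2))
                powr (1 / (real CARD('n) + 4))))"
proof (intro conjI)
  interpret prob_space M by fact
  define d where "d = CARD('n)"
  define V where "V = beta_V k \<gamma>"
  define Q where "Q = beta_Q TYPE('n) \<gamma>"
  define \<Delta> where "\<Delta> = (\<Sum>i\<in>UNIV. partial2 i i l x\<^sub>0)"
  note \<gamma> = \<open>\<gamma> \<ge> 0\<close>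
  have d: "0 < d" by (simp add: d_def)
  have V: "0 < V" and Q: "0 < Q"
    using \<gamma> by (auto simp: V_def Q_def beta_V_pos beta_Q_pos)
  have l0: "0 < l x\<^sub>0" using assms by auto
  have W: "W \<in> sets borel" "bounded W" using assms by auto
  obtain C where C: "0 < C"
    and hoelder: "\<And>x y i j. x \<in> W \<Longrightarrow> y \<in> W \<Longrightarrow>
      \<bar>partial2 i j l x - partial2 i j l y\<bar> \<le> C * norm (x - y) powr \<alpha>"
    using assms(12) by blast
  obtain G where G: "0 \<le> G" "\<And>u v. u \<in> W \<Longrightarrow> v \<in> W \<Longrightarrow> \<rho> (u, v) \<le> G * (l u * l v)"
  proof -
    obtain G where G: "0 < G" "\<And>p. p \<in> W \<times> W \<Longrightarrow> \<bar>pair_correlation l \<rho> p\<bar> \<le> G"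
      using assms(8) by (auto simp: bounded_pos)
    have "\<rho> (u, v) \<le> G * (l u * l v)" if "u \<in> W" "v \<in> W" for u v
    proof -
      have "0 < l u * l v" using that assms(9) by simp
      moreover have "\<rho> (u, v) / (l u * l v) \<le> G"
        using abs_le_D1[OF G(2)[of "(u, v)"]] that by (simp add: pair_correlation_def)
      ultimately show ?thesis by (simp add: divide_le_eq)
    qed
    then show ?thesis using G(1) by (intro that[of G]) auto
  qed
  obtain \<delta>\<^sub>1 where \<delta>1: "0 < \<delta>\<^sub>1" "cball x\<^sub>0 \<delta>\<^sub>1 \<subseteq> W"
    using \<open>open W\<close> \<open>x\<^sub>0 \<in> W\<close> open_contains_cball by blast
  have "l differentiable at x\<^sub>0"
    using assms by (intro C1_on_differentiable_at[of W]) (auto simp: C2_on_def)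
  then obtain L \<delta>\<^sub>2 where L: "0 \<le> L" and \<delta>2: "0 < \<delta>\<^sub>2"
    and lip: "\<And>v. norm v < \<delta>\<^sub>2 \<Longrightarrow> \<bar>l (x\<^sub>0 + v) - l x\<^sub>0\<bar> \<le> L * norm v"
    by (rule differentiable_imp_pointwise_lipschitz) blast
  have L_meas[measurable]: "(\<lambda>u. indicator W u * l u) \<in> borel_measurable borel"
    using assms(6) W(1) unfolding has_intensity_function_def
    by (subst (asm) borel_measurable_restrict_space_iff) (auto simp: mult.commute)

  define m where "m n = (LINT u|lborel. beta_kernel \<gamma> ((1 / h n) *\<^sub>R (x\<^sub>0 - u)) * (indicator W u * l u))" for n
  define A where "A n = (LINT u|lborel. (beta_kernel \<gamma> ((1 / h n) *\<^sub>R (x\<^sub>0 - u)))\<^sup>2 * (indicator W u * l u))" for n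
  note est = mse_kernel_estimator[OF assms(5) W assms(6,7) G \<gamma>, where x = x\<^sub>0 and \<theta> = "l x\<^sub>0"]
  show "\<forall>n\<ge>1. integrable M (\<lambda>\<omega>. (kernel_estimator \<gamma> W \<Phi> n (h n) x\<^sub>0 \<omega> - l x\<^sub>0)\<^sup>2)"
    using assms(14) est(1) by blast
  have "\<forall>n. \<exists>v. 1 \<le> n \<longrightarrow> \<bar>v - A n\<bar> \<le> (G + 1) * (m n)\<^sup>2 \<and>
      mse M (kernel_estimator \<gamma> W \<Phi> n (h n) x\<^sub>0) (l x\<^sub>0)
        = v / (real n * (h n ^ d)\<^sup>2) + (m n / h n ^ d - l x\<^sub>0)\<^sup>2"
    using assms(14) est(2) unfolding A_def m_def d_def by blast
  then obtain v where v: "\<And>n. 1 \<le> n \<Longrightarrow> \<bar>v n - A n\<bar> \<le> (G + 1) * (m n)\<^sup>2"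
    and mse: "\<And>n. 1 \<le> n \<Longrightarrow> mse M (kernel_estimator \<gamma> W \<Phi> n (h n) x\<^sub>0) (l x\<^sub>0)
        = v n / (real n * (h n ^ d)\<^sup>2) + (m n / h n ^ d - l x\<^sub>0)\<^sup>2"
    by metis

  define D where "D = (real d)\<^sup>2 * C / 2"
  have D: "0 \<le> D" using C by (simp add: D_def)
  define c where "c = V / 2 * \<Delta>"
  define R\<^sub>1 where "R\<^sub>1 n = (m n / h n ^ d - l x\<^sub>0)\<^sup>2 - h n ^ 4 * c\<^sup>2" for n
  define R\<^sub>2 where "R\<^sub>2 n = v n / (real n * (h n ^ d)\<^sup>2) - l x\<^sub>0 * Q / (real n * h n ^ d)" for n
  \<comment> \<open>For these \<open>n\<close> the rescaled kernel is supported inside \<open>W\<close>, where the Taylor and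
    Lipschitz bounds hold.\<close>
  have "\<forall>\<^sub>F n in sequentially. h n < min 1 (min \<delta>\<^sub>1 \<delta>\<^sub>2)"
    using \<open>h \<longlonglongrightarrow> 0\<close> \<delta>1 \<delta>2 by (intro order_tendstoD(2)[of h 0]) auto
  then have ev: "\<forall>\<^sub>F n in sequentially. 1 \<le> n \<and> 0 < h n \<and> h n \<le> 1 \<and> h n \<le> \<delta>\<^sub>1 \<and> h n < \<delta>\<^sub>2"
    using eventually_ge_at_top[of 1] by eventually_elim (use assms(14) in auto)
  have local: "x\<^sub>0 + w \<in> W \<and> \<bar>l (x\<^sub>0 + w) - l x\<^sub>0\<bar> \<le> L * norm w" if "norm w \<le> b" "b \<le> \<delta>\<^sub>1" "b < \<delta>\<^sub>2" for w b
    using that lip[of w] \<delta>1(2) by (auto simp: subset_iff dist_norm)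

  have R1: "R\<^sub>1 \<in> O(\<lambda>n. h n powr (4 + \<alpha>))"
  proof (rule bigoI[where c = "D * (2 * \<bar>c\<bar> + D)"], rule eventually_mono[OF ev])
    fix n assume n: "1 \<le> n \<and> 0 < h n \<and> h n \<le> 1 \<and> h n \<le> \<delta>\<^sub>1 \<and> h n < \<delta>\<^sub>2"
    have "\<bar>m n / h n ^ d - (l x\<^sub>0 + (h n)\<^sup>2 * c)\<bar> \<le> D * h n powr (2 + \<alpha>)"
      using kernel_mean_expansion[OF \<gamma> \<open>open W\<close> \<open>C2_on W l\<close> \<delta>1(2) L_meas \<open>\<alpha> > 0\<close> less_imp_le[OF C] hoelder, of "h n" k] n
      by (simp add: m_def d_def c_def V_def \<Delta>_def D_def)
    then show "norm (R\<^sub>1 n) \<le> D * (2 * \<bar>c\<bar> + D) * norm (h n powr (4 + \<alpha>))"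
      using squared_bias_remainder[of "h n" \<alpha> D "m n / h n ^ d - l x\<^sub>0" c] n D \<open>\<alpha> > 0\<close>
      by (simp add: R\<^sub>1_def diff_diff_eq)
  qed
  define B where "B = l x\<^sub>0 + L"
  have R2: "R\<^sub>2 \<in> O(\<lambda>n. 1 / (real n * h n ^ (CARD('n) - 1)))"
  proof (rule bigoI[where c = "(G + 1) * B\<^sup>2 + L * Q"], rule eventually_mono[OF ev])
    fix n assume n: "1 \<le> n \<and> 0 < h n \<and> h n \<le> 1 \<and> h n \<le> \<delta>\<^sub>1 \<and> h n < \<delta>\<^sub>2"
    have "\<bar>m n / h n ^ d - l x\<^sub>0 * (LINT z|lborel. beta_kernel \<gamma> (z :: real ^ 'n))\<bar>
        \<le> L * h n * (LINT z|lborel. beta_kernel \<gamma> (z :: real ^ 'n))"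
      unfolding m_def d_def using n
      by (intro kernel_weight_first_order integrable_beta_kernel_monomials(1) beta_kernel_nonneg
          beta_kernel_outside L_meas L local \<gamma>) auto
    then have "\<bar>m n / h n ^ d - l x\<^sub>0\<bar> \<le> L * h n"
      by (simp add: integral_beta_kernel[OF \<gamma>])
    also have "\<dots> \<le> L" using n L by (simp add: mult_left_le)
    finally have m: "\<bar>m n / h n ^ d\<bar> \<le> B" using l0 by (simp add: B_def)
    have "integrable lborel (\<lambda>z :: real ^ 'n. (beta_kernel \<gamma> z)\<^sup>2)"
      using integrable_beta_kernel_mult(2)[OF \<gamma>, of "\<lambda>_. 1" 1] by simp
    then have "\<bar>A n / h n ^ d - l x\<^sub>0 * Q\<bar> \<le> L * h n * Q"
      unfolding A_def d_def Q_def beta_Q_def using n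
      by (intro kernel_weight_first_order L_meas L local) (auto simp: beta_kernel_outside)
    then have A: "\<bar>A n / h n ^ d - l x\<^sub>0 * Q\<bar> \<le> L * Q * h n"
      by (simp add: ac_simps)
    have "\<bar>R\<^sub>2 n\<bar> \<le> ((G + 1) * B\<^sup>2 + L * Q) * (1 / (real n * h n ^ (d - 1)))"
      unfolding R\<^sub>2_def
      by (rule variance_remainder[OF _ _ d _ _ v m A]) (use n G(1) L Q in auto)
    then show "norm (R\<^sub>2 n) \<le> ((G + 1) * B\<^sup>2 + L * Q) * norm (1 / (real n * h n ^ (CARD('n) - 1)))"
      using n by (simp add: d_def)
  qed
  show "\<exists>R\<^sub>1 R\<^sub>2 :: nat \<Rightarrow> real.
       R\<^sub>1 \<in> O(\<lambda>n. h n powr (4 + \<alpha>)) \<and>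
       R\<^sub>2 \<in> O(\<lambda>n. 1 / (real n * h n ^ (CARD('n) - 1))) \<and>
       (\<forall>n\<ge>1. mse M (kernel_estimator \<gamma> W \<Phi> n (h n) x\<^sub>0) (l x\<^sub>0) =
          h n ^ 4 * ((beta_V k \<gamma>)\<^sup>2 / 4) * (\<Sum>i\<in>UNIV. partial2 i i l x\<^sub>0)\<^sup>2 +
          l x\<^sub>0 * beta_Q TYPE('n) \<gamma> / (real n * h n ^ CARD('n)) + R\<^sub>1 n + R\<^sub>2 n)"
  proof (intro exI conjI allI impI)
    fix n :: nat assume "n \<ge> 1"
    have c2: "c\<^sup>2 = V\<^sup>2 / 4 * \<Delta>\<^sup>2"
      by (simp add: c_def power_mult_distrib power_divide)
    show "mse M (kernel_estimator \<gamma> W \<Phi> n (h n) x\<^sub>0) (l x\<^sub>0) =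
          h n ^ 4 * ((beta_V k \<gamma>)\<^sup>2 / 4) * (\<Sum>i\<in>UNIV. partial2 i i l x\<^sub>0)\<^sup>2 +
          l x\<^sub>0 * beta_Q TYPE('n) \<gamma> / (real n * h n ^ CARD('n)) + R\<^sub>1 n + R\<^sub>2 n"
      using mse[OF \<open>n \<ge> 1\<close>] unfolding R\<^sub>1_def R\<^sub>2_def c2 V_def[symmetric] Q_def[symmetric] \<Delta>_def[symmetric] d_def[symmetric]
      by (simp add: mult.assoc)
  qed (fact R1 R2)+

  show "(\<Sum>i\<in>UNIV. partial2 i i l x\<^sub>0) \<noteq> 0 \<longrightarrow>
       (\<forall>n\<ge>1. \<forall>b. is_arg_min (asymptotic_mse k \<gamma> l x\<^sub>0 n) (\<lambda>b. b > 0) b \<longleftrightarrow>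
          b = 1 / real n powr (1 / (real CARD('n) + 4)) *
              (real CARD('n) * l x\<^sub>0 * beta_Q TYPE('n) \<gamma> /
               ((beta_V k \<gamma>)\<^sup>2 * (\<Sum>i\<in>UNIV. partial2 i i l x\<^sub>0)\<^sup>2))
                powr (1 / (real CARD('n) + 4)))"
    unfolding V_def[symmetric] Q_def[symmetric] \<Delta>_def[symmetric] d_def[symmetric]
  proof (intro impI allI)
    fix n :: nat and b :: real
    assume \<Delta>: "\<Delta> \<noteq> 0" and n: "1 \<le> n"
    define X where "X = real d * l x\<^sub>0 * Q / (V\<^sup>2 * \<Delta>\<^sup>2)"
    define h\<^sub>0 where "h\<^sub>0 = 1 / real n powr (1 / (real d + 4)) * X powr (1 / (real d + 4))"
    define a where "a = V\<^sup>2 / 4 * \<Delta>\<^sup>2"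
    have X: "0 < X" using d l0 Q V \<Delta> by (simp add: X_def)
    have a: "0 < a" using V \<Delta> by (simp add: a_def)
    \<comment> \<open>The root turns the closed form into the critical point equation for the bandwidth.\<close>
    have root: "(y powr (1 / (real d + 4))) ^ (d + 4) = y" if "0 < y" for y :: real
    proof -
      have "(y powr (1 / (real d + 4))) ^ (d + 4) = y powr (1 / (real d + 4) * real (d + 4))"
        using that by (simp add: powr_powr flip: powr_realpow)
      then show ?thesis using that by simp
    qed
    have h0: "0 < h\<^sub>0" using n X by (simp add: h\<^sub>0_def)
    have "h\<^sub>0 ^ (d + 4) = 1 / real n * X"
      unfolding h\<^sub>0_def power_mult_distrib power_one_over root[OF X] using n by (simp add: root)
    then have "4 * a * h\<^sub>0 ^ (d + 4) = real d * (l x\<^sub>0 * Q / real n)"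
      using V \<Delta> n by (simp add: a_def X_def)
    from is_arg_min_bandwidth[OF d a h0 this, of b]
    show "is_arg_min (asymptotic_mse k \<gamma> l x\<^sub>0 n) (\<lambda>b. b > 0) b \<longleftrightarrow>
        b = 1 / real n powr (1 / (real d + 4)) *
          (real d * l x\<^sub>0 * Q / (V\<^sup>2 * \<Delta>\<^sup>2)) powr (1 / (real d + 4))"
      by (simp add: asymptotic_mse_def[abs_def] h\<^sub>0_def X_def a_def V_def Q_def \<Delta>_def d_def mult_ac)
  qed
qed

end
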